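(* Let $\{A_i \mid i\in I\}$ be an arbitrary indexed family of finitely generated nilpotent groups whose nilpotency classes are bounded (there is an integer $c$ such that every $A_i$ has class at most $c$). Let $C$ be a group with monomorphisms $\phi_i: C\to A_i$ such that $\phi_i(C)$ is contained in the center of $A_i$ for every $i\in I$. Let $G=\{\prod^{*}_{i\in I}A_i;\ C\}$ be the generalized free product of the $A_i$ amalgamating $C$. Then $G$ is an extension of a free group by a nilpotent group. Furthermore, $G$ is residually solvable.
   Context: The generalized free product $\{\prod^{*}_{i\in I}A_i;\ C\}$ is the quotient of the free product of the $A_i$ by the normal closure of the elements $\phi_i(c)\phi_j(c)^{-1}$ ($c\in C$, $i,j\in I$). A group $G$ is an extension of $N$ by $Q$ if there is a short exact sequence $1\to N\to G\to Q\to 1$. A group $G$ is residually solvable if for every non-identity $g\in G$ there is a homomorphism from $G$ onto a solvable group under which the image of $g$ is not the identity. *)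

theory Defs
  imports "HOL-Algebra.Algebra"
begin

definition word_step :: "('x list \<times> 'x list) set \<Rightarrow> 'x list \<Rightarrow> 'x list \<Rightarrow> bool" where
  "word_step R x y \<longleftrightarrow> (\<exists>p s u v. (u, v) \<in> R \<and> x = p @ u @ s \<and> y = p @ v @ s)"

definition word_rel :: "'x set \<Rightarrow> ('x list \<times> 'x list) set \<Rightarrow> ('x list \<times> 'x list) set" where
  "word_rel L R = {(x, y). x \<in> lists L \<and> y \<in> lists L \<and> equivclp (word_step R) x y}"

text \<open>The monoid with generators \<open>L\<close> and defining relations \<open>u = v\<close> for \<open>(u, v) \<in> R\<close>,
  where \<open>R\<close> relates words over \<open>L\<close>.\<close>

definition word_monoid :: "'x set \<Rightarrow> ('x list \<times> 'x list) set \<Rightarrow> 'x list set monoid" where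
  "word_monoid L R =
     \<lparr>carrier = lists L // word_rel L R,
      monoid.mult = (\<lambda>U V. \<Union>u\<in>U. \<Union>v\<in>V. word_rel L R `` {u @ v}),
      monoid.one = word_rel L R `` {[]}\<rparr>"

text \<open>The letters \<open>(s, True)\<close> and \<open>(s, False)\<close> stand for \<open>s\<close> and its formal inverse.\<close>

definition free_group :: "'s set \<Rightarrow> ('s \<times> bool) list set monoid" where
  "free_group S = word_monoid (S \<times> UNIV) {([(s, b), (s, \<not> b)], []) | s b. s \<in> S}"

text \<open>Letting the basis range over subsets of the carrier type is no restriction, since a free
  group contains each of its bases.\<close>

definition is_free_group :: "('a, 'm) monoid_scheme \<Rightarrow> bool" where
  "is_free_group G \<longleftrightarrow> group G \<and> (\<exists>S :: 'a set. free_group S \<cong> G)"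

definition free_product_letters ::
    "'i set \<Rightarrow> ('i \<Rightarrow> ('a, 'm) monoid_scheme) \<Rightarrow> ('i \<times> 'a) set" where
  "free_product_letters I A = (SIGMA i:I. carrier (A i))"

definition free_product_rels ::
    "'i set \<Rightarrow> ('i \<Rightarrow> ('a, 'm) monoid_scheme) \<Rightarrow> (('i \<times> 'a) list \<times> ('i \<times> 'a) list) set" where
  "free_product_rels I A =
     {([(i, a), (i, b)], [(i, a \<otimes>\<^bsub>A i\<^esub> b)]) | i a b.
        i \<in> I \<and> a \<in> carrier (A i) \<and> b \<in> carrier (A i)}
     \<union> {([(i, \<one>\<^bsub>A i\<^esub>)], []) | i. i \<in> I}"

definition free_product ::
    "'i set \<Rightarrow> ('i \<Rightarrow> ('a, 'm) monoid_scheme) \<Rightarrow> ('i \<times> 'a) list set monoid" where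
  "free_product I A = word_monoid (free_product_letters I A) (free_product_rels I A)"

definition free_product_incl ::
    "'i set \<Rightarrow> ('i \<Rightarrow> ('a, 'm) monoid_scheme) \<Rightarrow> 'i \<Rightarrow> 'a \<Rightarrow> ('i \<times> 'a) list set" where
  "free_product_incl I A i a =
     word_rel (free_product_letters I A) (free_product_rels I A) `` {[(i, a)]}"

definition normal_closure :: "('a, 'm) monoid_scheme \<Rightarrow> 'a set \<Rightarrow> 'a set" where
  "normal_closure G S = \<Inter> {N. N \<lhd> G \<and> S \<subseteq> N}"

definition generalized_free_product ::
    "'i set \<Rightarrow> ('i \<Rightarrow> ('a, 'm) monoid_scheme) \<Rightarrow> ('c, 'n) monoid_scheme \<Rightarrow> ('i \<Rightarrow> 'c \<Rightarrow> 'a)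
       \<Rightarrow> ('i \<times> 'a) list set set monoid" where
  "generalized_free_product I A C \<phi> =
     (let P = free_product I A in
      P Mod normal_closure P
        {free_product_incl I A i (\<phi> i c) \<otimes>\<^bsub>P\<^esub> inv\<^bsub>P\<^esub> (free_product_incl I A j (\<phi> j c)) | i j c.
           i \<in> I \<and> j \<in> I \<and> c \<in> carrier C})"

definition group_center :: "('a, 'm) monoid_scheme \<Rightarrow> 'a set" where
  "group_center G = {z \<in> carrier G. \<forall>x \<in> carrier G. z \<otimes>\<^bsub>G\<^esub> x = x \<otimes>\<^bsub>G\<^esub> z}"

definition finitely_generated_group :: "('a, 'm) monoid_scheme \<Rightarrow> bool" where
  "finitely_generated_group G \<longleftrightarrow>
     group G \<and> (\<exists>S. finite S \<and> S \<subseteq> carrier G \<and> generate G S = carrier G)"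

text \<open>The indexing starts at \<open>0\<close>, so that the class of a nilpotent group is the least \<open>n\<close> for which
  the \<open>n\<close>-th term is trivial; the trivial group has class \<open>0\<close>.\<close>

primrec lower_central_series :: "('a, 'm) monoid_scheme \<Rightarrow> nat \<Rightarrow> 'a set" where
  "lower_central_series G 0 = carrier G"
| "lower_central_series G (Suc n) =
     generate G {x \<otimes>\<^bsub>G\<^esub> y \<otimes>\<^bsub>G\<^esub> inv\<^bsub>G\<^esub> x \<otimes>\<^bsub>G\<^esub> inv\<^bsub>G\<^esub> y | x y.
       x \<in> lower_central_series G n \<and> y \<in> carrier G}"

definition nilpotent_group :: "('a, 'm) monoid_scheme \<Rightarrow> bool" where
  "nilpotent_group G \<longleftrightarrow> group G \<and> (\<exists>n. lower_central_series G n = {\<one>\<^bsub>G\<^esub>})"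

text \<open>Meaningful for nilpotent groups only.\<close>

definition nilpotency_class :: "('a, 'm) monoid_scheme \<Rightarrow> nat" where
  "nilpotency_class G = (LEAST n. lower_central_series G n = {\<one>\<^bsub>G\<^esub>})"

text \<open>The library's \<open>short_exact_sequence\<close> requires all groups to live on one type.\<close>

definition group_extension ::
    "('a, 'm) monoid_scheme \<Rightarrow> ('b, 'n) monoid_scheme \<Rightarrow> ('q, 'k) monoid_scheme \<Rightarrow> bool" where
  "group_extension G N Q \<longleftrightarrow> group G \<and> group N \<and> group Q \<and>
     (\<exists>\<iota> \<in> mon N G. \<exists>\<pi> \<in> epi G Q. \<iota> ` carrier N = kernel G Q \<pi>)"

text \<open>Every homomorphic image of \<open>G\<close> is isomorphic to a quotient of \<open>G\<close>, whose elements are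
  subsets of the carrier; so restricting \<open>H\<close> to this type loses no generality.\<close>

definition residually_solvable :: "('a, 'm) monoid_scheme \<Rightarrow> bool" where
  "residually_solvable G \<longleftrightarrow> group G \<and>
     (\<forall>g \<in> carrier G. g \<noteq> \<one>\<^bsub>G\<^esub> \<longrightarrow>
        (\<exists>(H :: 'a set monoid) h. group H \<and> solvable H \<and> h \<in> epi G H \<and> h g \<noteq> \<one>\<^bsub>H\<^esub>))"

lemma equivclp_map:
  assumes "equivclp r x y" and "\<And>x y. r x y \<Longrightarrow> s (f x) (f y)"
  shows "equivclp s (f x) (f y)"
  using assms(1)
proof (induction rule: equivclp_induct)
  case (step y z)
  then have "equivclp s (f y) (f z)"
    using assms(2) by (meson equivclp_sym r_into_equivclp)
  with step.IH show ?case by (rule equivclp_trans)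
qed simp

lemma word_step_append:
  assumes "word_step R x y"
  shows "word_step R (p @ x @ s) (p @ y @ s)"
proof -
  obtain p' s' u v where "(u, v) \<in> R" "x = p' @ u @ s'" "y = p' @ v @ s'"
    using assms unfolding word_step_def by blast
  then show ?thesis
    unfolding word_step_def
    by (intro exI[of _ "p @ p'"] exI[of _ "s' @ s"] exI[of _ u] exI[of _ v]) simp
qed

lemma equiv_word_rel: "equiv (lists L) (word_rel L R)"
proof (rule equivI)
  show "sym (word_rel L R)" unfolding word_rel_def by (auto intro: symI dest: equivclp_sym)
  show "trans (word_rel L R)" unfolding word_rel_def
    by (rule transI) (auto intro: equivclp_trans)
qed (auto simp: word_rel_def refl_on_def)

lemma word_rel_append:
  assumes "(u, u') \<in> word_rel L R" "(v, v') \<in> word_rel L R"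
  shows "(u @ v, u' @ v') \<in> word_rel L R"
proof -
  have "equivclp (word_step R) (u @ v) (u' @ v)"
    using equivclp_map[of "word_step R" u u' "word_step R" "\<lambda>x. x @ v"] assms(1)
      word_step_append[of R _ _ "[]" v] by (simp add: word_rel_def)
  moreover have "equivclp (word_step R) (u' @ v) (u' @ v')"
    using equivclp_map[of "word_step R" v v' "word_step R" "\<lambda>x. u' @ x"] assms(2)
      word_step_append[of R _ _ u' "[]"] by (simp add: word_rel_def)
  ultimately have "equivclp (word_step R) (u @ v) (u' @ v')" by (rule equivclp_trans)
  with assms show ?thesis by (simp add: word_rel_def)
qed

lemma word_rel_step:
  assumes "(u, v) \<in> R" "u \<in> lists L" "v \<in> lists L"
  shows "(u, v) \<in> word_rel L R"
proof -
  have "word_step R u v"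
    unfolding word_step_def using assms(1)
    by (intro exI[of _ "[]"] exI[of _ u] exI[of _ v]) simp
  with assms show ?thesis by (auto simp: word_rel_def)
qed

lemma carrier_word_monoid: "carrier (word_monoid L R) = lists L // word_rel L R"
  by (simp add: word_monoid_def)

lemma one_word_monoid: "\<one>\<^bsub>word_monoid L R\<^esub> = word_rel L R `` {[]}"
  by (simp add: word_monoid_def)

lemma mult_word_monoid:
  assumes "u \<in> lists L" "v \<in> lists L"
  shows "word_rel L R `` {u} \<otimes>\<^bsub>word_monoid L R\<^esub> word_rel L R `` {v} = word_rel L R `` {u @ v}"
proof -
  let ?r = "word_rel L R"
  have "?r `` {u' @ v'} = ?r `` {u @ v}" if "u' \<in> ?r `` {u}" "v' \<in> ?r `` {v}" for u' v'
    using that word_rel_append[of u u' L R v v'] equiv_class_eq[OF equiv_word_rel]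
    by (metis Image_singleton_iff)
  then have "(\<Union>u'\<in>?r `` {u}. \<Union>v'\<in>?r `` {v}. ?r `` {u' @ v'})
      = (\<Union>u'\<in>?r `` {u}. \<Union>v'\<in>?r `` {v}. ?r `` {u @ v})"
    by (intro SUP_cong refl) blast
  also have "\<dots> = ?r `` {u @ v}"
    using assms[THEN equiv_class_self[OF equiv_word_rel]] by auto
  finally show ?thesis by (simp add: word_monoid_def)
qed

lemma group_word_monoid:
  assumes inv: "\<And>x. x \<in> L \<Longrightarrow> \<exists>y \<in> L. ([y, x], []) \<in> word_rel L R"
  shows "group (word_monoid L R)"
proof (rule groupI)
  let ?W = "word_monoid L R" and ?r = "word_rel L R"
  have cls: "\<exists>u \<in> lists L. U = ?r `` {u}" if "U \<in> carrier ?W" for U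
    using that by (auto simp: carrier_word_monoid elim!: quotientE)
  have mem: "?r `` {u} \<in> carrier ?W" if "u \<in> lists L" for u
    using that by (simp add: carrier_word_monoid quotientI)
  show "\<one>\<^bsub>?W\<^esub> \<in> carrier ?W" by (simp add: one_word_monoid mem)
  show "U \<otimes>\<^bsub>?W\<^esub> V \<in> carrier ?W" if "U \<in> carrier ?W" "V \<in> carrier ?W" for U V
    using cls[OF that(1)] cls[OF that(2)] mem mult_word_monoid append_in_lists_conv by metis
  show "U \<otimes>\<^bsub>?W\<^esub> V \<otimes>\<^bsub>?W\<^esub> Z = U \<otimes>\<^bsub>?W\<^esub> (V \<otimes>\<^bsub>?W\<^esub> Z)"
    if UVZ: "U \<in> carrier ?W" "V \<in> carrier ?W" "Z \<in> carrier ?W" for U V Z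
  proof -
    obtain u v z where "u \<in> lists L" "v \<in> lists L" "z \<in> lists L"
      and "U = ?r `` {u}" "V = ?r `` {v}" "Z = ?r `` {z}"
      using cls UVZ by meson
    then show ?thesis by (simp add: mult_word_monoid)
  qed
  show "\<one>\<^bsub>?W\<^esub> \<otimes>\<^bsub>?W\<^esub> U = U" if "U \<in> carrier ?W" for U
    using cls[OF that] mult_word_monoid[of "[]" L] one_word_monoid by (metis append_Nil lists.Nil)
  have "\<exists>v \<in> lists L. (v @ u, []) \<in> ?r" if "u \<in> lists L" for u
    using that
  proof (induction u)
    case Nil
    then show ?case by (intro bexI[of _ "[]"]) (auto simp: word_rel_def)
  next
    case (Cons x u)
    then obtain v y where v: "v \<in> lists L" "(v @ u, []) \<in> ?r"
      and y: "y \<in> L" "([y, x], []) \<in> ?r" using inv by meson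
    have vv: "(v, v) \<in> ?r" and uu: "(u, u) \<in> ?r"
      using v Cons by (auto simp: word_rel_def)
    have "(v @ [y, x] @ u, v @ [] @ u) \<in> ?r"
      using word_rel_append[OF vv word_rel_append[OF y(2) uu]] .
    then have "((v @ [y]) @ x # u, []) \<in> ?r"
      using v(2) equiv_word_rel[of L R] by (auto dest: equivE transD)
    then show ?case using v(1) y(1) by (intro bexI[of _ "v @ [y]"]) auto
  qed
  then show "\<exists>V \<in> carrier ?W. V \<otimes>\<^bsub>?W\<^esub> U = \<one>\<^bsub>?W\<^esub>" if "U \<in> carrier ?W" for U
    using cls[OF that] mem equiv_class_eq[OF equiv_word_rel]
    by (metis mult_word_monoid one_word_monoid)
qed

lemma group_free_group: "group (free_group S)"
  unfolding free_group_def
proof (rule group_word_monoid)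
  fix x assume "x \<in> S \<times> (UNIV :: bool set)"
  then obtain s b where x: "x = (s, b)" "s \<in> S" by blast
  then have "([(s, \<not> b), x], []) \<in> {([(s, b), (s, \<not> b)], []) | s b. s \<in> S}" by auto
  then show "\<exists>y \<in> S \<times> UNIV. ([y, x], [])
      \<in> word_rel (S \<times> UNIV) {([(s, b), (s, \<not> b)], []) | s b. s \<in> S}"
    using x by (intro bexI[of _ "(s, \<not> b)"] word_rel_step) auto
qed

lemma group_free_product:
  assumes "\<And>i. i \<in> I \<Longrightarrow> group (A i)"
  shows "group (free_product I A)"
  unfolding free_product_def
proof (rule group_word_monoid)
  let ?L = "free_product_letters I A" and ?R = "free_product_rels I A"
  fix x assume "x \<in> ?L"
  then obtain i a where x: "x = (i, a)" "i \<in> I" "a \<in> carrier (A i)"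
    by (auto simp: free_product_letters_def)
  interpret group "A i" using assms x by blast
  let ?y = "(i, inv\<^bsub>A i\<^esub> a)"
  have L: "x \<in> ?L" "?y \<in> ?L" "(i, \<one>\<^bsub>A i\<^esub>) \<in> ?L"
    using x by (auto simp: free_product_letters_def)
  have "([?y, x], [(i, \<one>\<^bsub>A i\<^esub>)]) \<in> ?R"
    unfolding free_product_rels_def using x l_inv[of a] inv_closed[of a]
    by (auto intro!: exI[of _ i] exI[of _ "inv\<^bsub>A i\<^esub> a"] exI[of _ a])
  then have "([?y, x], [(i, \<one>\<^bsub>A i\<^esub>)]) \<in> word_rel ?L ?R" using L by (intro word_rel_step) auto
  moreover have "([(i, \<one>\<^bsub>A i\<^esub>)], []) \<in> word_rel ?L ?R"
    using x L by (intro word_rel_step) (auto simp: free_product_rels_def)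
  ultimately have "([?y, x], []) \<in> word_rel ?L ?R"
    using equiv_word_rel[of ?L ?R] by (meson equivE transD)
  then show "\<exists>y \<in> ?L. ([y, x], []) \<in> word_rel ?L ?R" using L(2) by blast
qed

lemma free_product_incl_hom:
  assumes "i \<in> I" "group (A i)"
  shows "free_product_incl I A i \<in> hom (A i) (free_product I A)"
proof (rule homI)
  interpret group "A i" by fact
  let ?L = "free_product_letters I A" and ?R = "free_product_rels I A"
  have L: "[(i, a)] \<in> lists ?L" if "a \<in> carrier (A i)" for a
    using that assms by (auto simp: free_product_letters_def)
  show "free_product_incl I A i a \<in> carrier (free_product I A)" if "a \<in> carrier (A i)" for a
    using L[OF that] by (simp add: free_product_incl_def free_product_def carrier_word_monoid quotientI)
  show "free_product_incl I A i (a \<otimes>\<^bsub>A i\<^esub> b) =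
      free_product_incl I A i a \<otimes>\<^bsub>free_product I A\<^esub> free_product_incl I A i b"
    if ab: "a \<in> carrier (A i)" "b \<in> carrier (A i)" for a b
  proof -
    have r: "([(i, a), (i, b)], [(i, a \<otimes>\<^bsub>A i\<^esub> b)]) \<in> ?R"
      using ab assms by (auto simp: free_product_rels_def)
    have eq: "free_product_incl I A i a \<otimes>\<^bsub>free_product I A\<^esub> free_product_incl I A i b =
        word_rel ?L ?R `` {[(i, a), (i, b)]}"
      using mult_word_monoid[OF L[OF ab(1)] L[OF ab(2)], of ?R]
      by (simp add: free_product_incl_def free_product_def)
    have "([(i, a), (i, b)], [(i, a \<otimes>\<^bsub>A i\<^esub> b)]) \<in> word_rel ?L ?R"
      using r L ab by (intro word_rel_step) auto
    then show ?thesis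
      using eq equiv_class_eq[OF equiv_word_rel] unfolding free_product_incl_def by metis
  qed
qed

lemma (in group) normal_closure_normal:
  assumes "S \<subseteq> carrier G"
  shows "normal_closure G S \<lhd> G"
proof -
  let ?F = "{N. N \<lhd> G \<and> S \<subseteq> N}"
  have "carrier G \<in> ?F"
    using assms by (auto simp: normal_inv_iff subgroup_self)
  then have ne: "?F \<noteq> {}" by blast
  have "subgroup (\<Inter> ?F) G"
    using ne by (intro subgroups_Inter) (auto simp: normal_inv_iff)
  then show ?thesis
    unfolding normal_closure_def by (subst normal_inv_iff) (auto simp: normal_inv_iff)
qed

lemma group_generalized_free_product:
  assumes "\<And>i. i \<in> I \<Longrightarrow> group (A i)" and "\<And>i. i \<in> I \<Longrightarrow> \<phi> i \<in> hom C (A i)"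
  shows "group (generalized_free_product I A C \<phi>)"
proof -
  interpret P: group "free_product I A" using assms(1) by (rule group_free_product)
  have "free_product_incl I A i (\<phi> i c) \<in> carrier (free_product I A)"
    if "i \<in> I" "c \<in> carrier C" for i c
    using that assms free_product_incl_hom by (metis hom_in_carrier)
  then show ?thesis
    unfolding generalized_free_product_def Let_def
    by (intro normal.factorgroup_is_group P.normal_closure_normal) auto
qed

end

theory Submission
  imports Defs
begin

text \<open>Adding the relations that distinct factors commute turns \<open>G\<close> into the central product of the
  \<open>A i\<close>, which is nilpotent and into which every \<open>A i\<close> embeds; let \<open>K\<close> be the kernel. Freeness of
  \<open>K\<close> is Reidemeister-Schreier rewriting. The central product is coordinatised as
  \<open>coords \<times> carrier C\<close>, where a coordinate vector picks finitely many nontrivial coset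
  representatives of \<open>A i\<close> modulo \<open>C\<close>, and \<open>\<tau>\<close> is a Schreier transversal along a spanning tree
  of coordinate vectors. For the free group \<open>F\<close> on the nontrivial Schreier generators, \<open>G\<close> acts on
  \<open>coords \<times> carrier C \<times> carrier F\<close> by a cocycle; the orbit of the base point recovers \<open>F\<close> from
  \<open>K\<close> and conversely, so that no normal form theorem is needed.

  A free group is residually solvable: a nontrivial reduced word acts nontrivially on integer
  sequences through unitriangular operators, one matrix entry being the product of the exponents of
  its syllables. Since \<open>K\<close> is free and contains a term of the derived series of \<open>G\<close>, the derived
  series of \<open>G\<close> has trivial intersection.\<close>

section \<open>Presented monoids and free groups\<close>

text \<open>The obstacle is that \<open>G\<close> is known only by generators and relations:
  freeness of \<open>K\<close> needs inequalities between elements, and an action is used to supply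
  them. Centrality of \<open>C\<close> makes the action explicit: multiplying by an element of
  \<open>C\<close> keeps every coset representative and changes only the \<open>C\<close>-component,
  in the same way for every factor, so the prescriptions for the separate factors agree on
  \<open>C\<close> and glue to an action of \<open>G\<close>. Among the vectors that differ only at
  coordinate \<open>i\<close>, each \<open>q\<close> is joined to the single vector
  \<open>clear q i\<close>, so one Schreier generator per pair \<open>(q, i)\<close> suffices and a
  move between two of these vectors passes through that centre. The bound on the classes enters
  through the lower central series of the central product: its \<open>n\<close>-th term lies in the
  subgroup generated by the images of the \<open>n\<close>-th terms of the factors, so it dies at
  any index at which all factors are trivial at once.\<close>

abbreviation word_value :: "('h, 'm) monoid_scheme \<Rightarrow> ('x \<Rightarrow> 'h) \<Rightarrow> 'x list \<Rightarrow> 'h" where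
  "word_value H f w \<equiv> foldr (\<lambda>x y. f x \<otimes>\<^bsub>H\<^esub> y) w \<one>\<^bsub>H\<^esub>"

lemma (in group) word_value_closed:
  "f \<in> L \<rightarrow> carrier G \<Longrightarrow> w \<in> lists L \<Longrightarrow> word_value G f w \<in> carrier G"
  by (induction w) auto

lemma (in group) word_value_append:
  assumes "f \<in> L \<rightarrow> carrier G" "u \<in> lists L" "v \<in> lists L"
  shows "word_value G f (u @ v) = word_value G f u \<otimes> word_value G f v"
  using assms(2)
proof (induction u)
  case Nil
  then show ?case using word_value_closed[OF assms(1,3)] by simp
next
  case (Cons x u)
  then have "f x \<in> carrier G" using assms(1) by auto
  then show ?case
    using Cons word_value_closed[OF assms(1)] assms(3) by (simp add: m_assoc)
qed

text \<open>\<open>equivclp\<close> uses relations in both directions and does not restrict the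
  intermediate words. A chain starting in \<open>lists L\<close> cannot leave it, since both sides
  of every relation are words over \<open>L\<close>; hence each step is treated as an equivalence of
  memberships.\<close>

lemma (in group) word_value_equivclp:
  assumes f: "f \<in> L \<rightarrow> carrier G"
    and R: "\<And>u v. (u, v) \<in> R \<Longrightarrow>
      u \<in> lists L \<and> v \<in> lists L \<and> word_value G f u = word_value G f v"
    and "equivclp (word_step R) x y" "x \<in> lists L"
  shows "y \<in> lists L \<and> word_value G f x = word_value G f y"
proof -
  have step_iff: "(x \<in> lists L \<longleftrightarrow> y \<in> lists L) \<and>
      (x \<in> lists L \<longrightarrow> word_value G f x = word_value G f y)" if xy: "word_step R x y" for x y
  proof -
    obtain p s u v where uv: "(u, v) \<in> R" and x: "x = p @ u @ s" and y: "y = p @ v @ s"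
      using xy unfolding word_step_def by blast
    have "x \<in> lists L \<longleftrightarrow> y \<in> lists L" using R[OF uv] by (simp add: x y)
    moreover have "word_value G f x = word_value G f y" if "x \<in> lists L"
    proof -
      have ps: "p \<in> lists L" "s \<in> lists L" using that by (auto simp: x)
      have "word_value G f (p @ w @ s) = word_value G f p \<otimes> (word_value G f w \<otimes> word_value G f s)"
        if "w \<in> lists L" for w
        using that ps by (simp only: word_value_append[OF f] append_in_lists_conv simp_thms)
      then show ?thesis unfolding x y using R[OF uv] by simp
    qed
    ultimately show ?thesis by blast
  qed
  show ?thesis
    using assms(3,4)
  proof (induction rule: equivclp_induct)
    case (step y z)
    have "(y \<in> lists L \<longleftrightarrow> z \<in> lists L) \<and> (y \<in> lists L \<longrightarrow> word_value G f y = word_value G f z)"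
      using step.hyps(2) step_iff[of y z] step_iff[of z y] by presburger
    with step show ?case by simp
  qed simp
qed

lemma word_rel_classE:
  assumes "U \<in> carrier (word_monoid L R)"
  obtains u where "u \<in> lists L" "U = word_rel L R `` {u}"
  using assms by (auto simp: carrier_word_monoid elim!: quotientE)

lemma word_rel_class_closed:
  "u \<in> lists L \<Longrightarrow> word_rel L R `` {u} \<in> carrier (word_monoid L R)"
  by (simp add: carrier_word_monoid quotientI)

lemma word_monoid_universal:
  assumes "group H" and f: "f \<in> L \<rightarrow> carrier H"
    and R: "\<And>u v. (u, v) \<in> R \<Longrightarrow>
      u \<in> lists L \<and> v \<in> lists L \<and> word_value H f u = word_value H f v"
  obtains h where "h \<in> hom (word_monoid L R) H"
    "\<And>u. u \<in> lists L \<Longrightarrow> h (word_rel L R `` {u}) = word_value H f u"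
proof -
  interpret H: group H by fact
  define h where "h U = the_elem (word_value H f ` U)" for U
  have h: "h (word_rel L R `` {u}) = word_value H f u" if u: "u \<in> lists L" for u
  proof -
    have "word_value H f v = word_value H f u" if "v \<in> word_rel L R `` {u}" for v
      using that H.word_value_equivclp[OF f R _ u, of R v] by (auto simp: word_rel_def)
    moreover have "u \<in> word_rel L R `` {u}" using u by (auto simp: word_rel_def)
    ultimately have "word_value H f ` (word_rel L R `` {u}) = {word_value H f u}" by blast
    then show ?thesis by (simp add: h_def)
  qed
  have "h \<in> hom (word_monoid L R) H"
  proof (rule homI)
    fix U V assume "U \<in> carrier (word_monoid L R)" "V \<in> carrier (word_monoid L R)"
    then obtain u v where "u \<in> lists L" "U = word_rel L R `` {u}" "v \<in> lists L" "V = word_rel L R `` {v}"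
      by (meson word_rel_classE)
    then show "h U \<in> carrier H" "h (U \<otimes>\<^bsub>word_monoid L R\<^esub> V) = h U \<otimes>\<^bsub>H\<^esub> h V"
      using H.word_value_closed[OF f] H.word_value_append[OF f] by (auto simp: mult_word_monoid h)
  qed
  with h that show thesis by blast
qed

lemma word_monoid_generated:
  assumes "group (word_monoid L R)"
  shows "carrier (word_monoid L R) = generate (word_monoid L R) ((\<lambda>x. word_rel L R `` {[x]}) ` L)"
    (is "_ = generate ?W ?X")
proof
  interpret W: group ?W by fact
  have "?X \<subseteq> carrier ?W" by (auto intro!: word_rel_class_closed)
  then show "generate ?W ?X \<subseteq> carrier ?W" by (rule W.generate_incl)
  show "carrier ?W \<subseteq> generate ?W ?X"
  proof
    fix U assume "U \<in> carrier ?W"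
    then obtain u where "u \<in> lists L" and U: "U = word_rel L R `` {u}" by (rule word_rel_classE)
    from this(1) have "word_rel L R `` {u} \<in> generate ?W ?X"
    proof (induction u)
      case Nil
      then show ?case by (metis one_word_monoid generate.one)
    next
      case (Cons x u)
      have "word_rel L R `` {[x]} \<otimes>\<^bsub>?W\<^esub> word_rel L R `` {u} \<in> generate ?W ?X"
        using Cons by (intro generate.eng) (auto intro: generate.incl)
      then show ?case using Cons by (simp add: mult_word_monoid)
    qed
    with U show "U \<in> generate ?W ?X" by simp
  qed
qed

definition free_gen :: "'s set \<Rightarrow> 's \<Rightarrow> ('s \<times> bool) list set" where
  "free_gen S s = word_rel (S \<times> UNIV) {([(s, b), (s, \<not> b)], []) | s b. s \<in> S} `` {[(s, True)]}"

lemma free_gen_closed: "s \<in> S \<Longrightarrow> free_gen S s \<in> carrier (free_group S)"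
  unfolding free_gen_def free_group_def by (rule word_rel_class_closed) auto

lemma free_group_universal:
  assumes "group H" and f: "f \<in> S \<rightarrow> carrier H"
  obtains h where "h \<in> hom (free_group S) H" "\<And>s. s \<in> S \<Longrightarrow> h (free_gen S s) = f s"
proof -
  interpret H: group H by fact
  let ?R = "{([(s, b), (s, \<not> b)], []) | s b. s \<in> S}" and ?L = "S \<times> (UNIV :: bool set)"
  define g where "g = (\<lambda>(s, b). if b then f s else inv\<^bsub>H\<^esub> f s)"
  have g: "g \<in> ?L \<rightarrow> carrier H" using f by (auto simp: g_def dest: funcset_mem)
  have "u \<in> lists ?L \<and> v \<in> lists ?L \<and> word_value H g u = word_value H g v"
    if "(u, v) \<in> ?R" for u v
    using that f by (auto simp: g_def Pi_iff)
  from word_monoid_universal[OF \<open>group H\<close> g this] obtain h where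
    h: "h \<in> hom (word_monoid ?L ?R) H" "\<And>u. u \<in> lists ?L \<Longrightarrow> h (word_rel ?L ?R `` {u}) = word_value H g u"
    by blast
  have "h (free_gen S s) = f s" if "s \<in> S" for s
    using that h(2)[of "[(s, True)]"] funcset_mem[OF f that] by (simp add: g_def free_gen_def)
  with h(1) show thesis using that unfolding free_group_def by blast
qed

lemma free_group_generated:
  "carrier (free_group S) = generate (free_group S) (free_gen S ` S)"
proof
  interpret F: group "free_group S" by (rule group_free_group)
  let ?R = "{([(s, b), (s, \<not> b)], []) | s b. s \<in> S}" and ?L = "S \<times> (UNIV :: bool set)"
  let ?g = "generate (free_group S) (free_gen S ` S)"
  have sub: "free_gen S ` S \<subseteq> carrier (free_group S)" by (auto intro: free_gen_closed)
  show "?g \<subseteq> carrier (free_group S)" by (rule F.generate_incl[OF sub])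
  have "word_rel ?L ?R `` {[(s, b)]} \<in> ?g" if s: "s \<in> S" for s b
  proof (cases b)
    case True
    then show ?thesis using s generate.incl[of "free_gen S s" "free_gen S ` S"] by (simp add: free_gen_def)
  next
    case False
    let ?x = "word_rel ?L ?R `` {[(s, False)]}"
    have L: "[(s, True)] \<in> lists ?L" "[(s, False)] \<in> lists ?L" using s by auto
    have x: "?x \<in> carrier (free_group S)"
      unfolding free_group_def using L by (intro word_rel_class_closed)
    have "([(s, False), (s, True)], []) \<in> word_rel ?L ?R"
      using s by (intro word_rel_step) auto
    then have "?x \<otimes>\<^bsub>free_group S\<^esub> free_gen S s = \<one>\<^bsub>free_group S\<^esub>"
      unfolding free_group_def free_gen_def one_word_monoid
      by (subst mult_word_monoid[OF L(2,1)]) (simp add: equiv_class_eq[OF equiv_word_rel])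
    then have "?x = inv\<^bsub>free_group S\<^esub> free_gen S s"
      by (rule F.inv_equality[symmetric, OF _ free_gen_closed[OF s] x])
    then show ?thesis using False s generate.inv[of "free_gen S s" "free_gen S ` S"] by simp
  qed
  then have "(\<lambda>x. word_rel ?L ?R `` {[x]}) ` ?L \<subseteq> ?g" by (intro image_subsetI) (elim SigmaE, simp only:)
  from F.generate_subgroup_incl[OF this F.generate_is_subgroup[OF sub]]
  show "carrier (free_group S) \<subseteq> ?g"
    by (simp only: word_monoid_generated[OF group_free_group[of S, unfolded free_group_def],
          folded free_group_def])
qed

section \<open>Generalized free products\<close>

lemma free_product_universal:
  assumes "group H" and f: "\<And>i. i \<in> I \<Longrightarrow> f i \<in> hom (A i) H" and A: "\<And>i. i \<in> I \<Longrightarrow> group (A i)"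
  obtains h where "h \<in> hom (free_product I A) H"
    "\<And>i a. i \<in> I \<Longrightarrow> a \<in> carrier (A i) \<Longrightarrow> h (free_product_incl I A i a) = f i a"
proof -
  interpret H: group H by fact
  let ?L = "free_product_letters I A" and ?R = "free_product_rels I A"
  define g where "g = (\<lambda>(i, a). f i a)"
  have f': "f i a \<in> carrier H" if "i \<in> I" "a \<in> carrier (A i)" for i a
    using f[OF that(1)] that(2) by (rule hom_in_carrier)
  have g: "g \<in> ?L \<rightarrow> carrier H" using f' by (auto simp: g_def free_product_letters_def)
  have "u \<in> lists ?L \<and> v \<in> lists ?L \<and> word_value H g u = word_value H g v"
    if uv: "(u, v) \<in> ?R" for u v
  proof -
    consider (m) i a b where "i \<in> I" "a \<in> carrier (A i)" "b \<in> carrier (A i)"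
        "u = [(i, a), (i, b)]" "v = [(i, a \<otimes>\<^bsub>A i\<^esub> b)]"
      | (o) i where "i \<in> I" "u = [(i, \<one>\<^bsub>A i\<^esub>)]" "v = []"
      using uv unfolding free_product_rels_def by blast
    then show ?thesis
    proof cases
      case m
      interpret Ai: group "A i" using A[OF m(1)] .
      show ?thesis using m f' hom_mult[OF f[OF m(1)]] by (simp add: g_def free_product_letters_def)
    next
      case o
      interpret Ai: group "A i" using A[OF o(1)] .
      show ?thesis
        using o hom_one[OF f[OF o(1)] Ai.is_group H.is_group] by (simp add: g_def free_product_letters_def)
    qed
  qed
  from word_monoid_universal[OF \<open>group H\<close> g this] obtain h where
    h: "h \<in> hom (word_monoid ?L ?R) H" "\<And>u. u \<in> lists ?L \<Longrightarrow> h (word_rel ?L ?R `` {u}) = word_value H g u"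
    by blast
  have "h (free_product_incl I A i a) = f i a" if "i \<in> I" "a \<in> carrier (A i)" for i a
    using that f' h(2)[of "[(i, a)]"] by (simp add: g_def free_product_incl_def free_product_letters_def)
  with h(1) show thesis using that unfolding free_product_def by blast
qed

lemma free_product_generated:
  assumes "\<And>i. i \<in> I \<Longrightarrow> group (A i)"
  shows "carrier (free_product I A) =
    generate (free_product I A) (\<Union>i\<in>I. free_product_incl I A i ` carrier (A i))"
proof -
  have "(\<lambda>x. word_rel (free_product_letters I A) (free_product_rels I A) `` {[x]}) ` free_product_letters I A
      = (\<Union>i\<in>I. free_product_incl I A i ` carrier (A i))"
    unfolding free_product_incl_def free_product_letters_def by force
  then show ?thesis
    using word_monoid_generated[of "free_product_letters I A" "free_product_rels I A"]
      group_free_product[of I A, OF assms] unfolding free_product_def by metis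
qed

definition amalgam_relators ::
    "'i set \<Rightarrow> ('i \<Rightarrow> ('a, 'm) monoid_scheme) \<Rightarrow> ('c, 'n) monoid_scheme \<Rightarrow> ('i \<Rightarrow> 'c \<Rightarrow> 'a)
       \<Rightarrow> ('i \<times> 'a) list set set" where
  "amalgam_relators I A C \<phi> =
     {free_product_incl I A i (\<phi> i c) \<otimes>\<^bsub>free_product I A\<^esub>
        inv\<^bsub>free_product I A\<^esub> (free_product_incl I A j (\<phi> j c)) | i j c.
      i \<in> I \<and> j \<in> I \<and> c \<in> carrier C}"

definition amalgam_incl ::
    "'i set \<Rightarrow> ('i \<Rightarrow> ('a, 'm) monoid_scheme) \<Rightarrow> ('c, 'n) monoid_scheme \<Rightarrow> ('i \<Rightarrow> 'c \<Rightarrow> 'a)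
       \<Rightarrow> 'i \<Rightarrow> 'a \<Rightarrow> ('i \<times> 'a) list set set" where
  "amalgam_incl I A C \<phi> i a =
     normal_closure (free_product I A) (amalgam_relators I A C \<phi>)
       #>\<^bsub>free_product I A\<^esub> free_product_incl I A i a"

lemma generalized_free_product_Mod:
  "generalized_free_product I A C \<phi> =
     free_product I A Mod normal_closure (free_product I A) (amalgam_relators I A C \<phi>)"
  by (simp add: generalized_free_product_def amalgam_relators_def Let_def)

context
  fixes I :: "'i set" and A :: "'i \<Rightarrow> ('a, 'm) monoid_scheme"
    and C :: "('c, 'n) monoid_scheme" and \<phi> :: "'i \<Rightarrow> 'c \<Rightarrow> 'a"
  assumes A: "\<And>i. i \<in> I \<Longrightarrow> group (A i)" and \<phi>: "\<And>i. i \<in> I \<Longrightarrow> \<phi> i \<in> hom C (A i)"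
begin

interpretation P: group "free_product I A" using A by (rule group_free_product)

lemma free_product_incl_closed:
  "i \<in> I \<Longrightarrow> a \<in> carrier (A i) \<Longrightarrow> free_product_incl I A i a \<in> carrier (free_product I A)"
  using free_product_incl_hom[of i I A] A by (auto intro: hom_in_carrier)

lemma free_product_incl_\<phi>_closed:
  "i \<in> I \<Longrightarrow> c \<in> carrier C \<Longrightarrow> free_product_incl I A i (\<phi> i c) \<in> carrier (free_product I A)"
  using free_product_incl_closed \<phi> by (meson hom_in_carrier)

lemma amalgam_relators_closed: "amalgam_relators I A C \<phi> \<subseteq> carrier (free_product I A)"
  using free_product_incl_\<phi>_closed by (auto simp: amalgam_relators_def)

interpretation N: normal "normal_closure (free_product I A) (amalgam_relators I A C \<phi>)" "free_product I A"
  by (rule P.normal_closure_normal[OF amalgam_relators_closed])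

lemma amalgam_incl_hom:
  "i \<in> I \<Longrightarrow> amalgam_incl I A C \<phi> i \<in> hom (A i) (generalized_free_product I A C \<phi>)"
  unfolding generalized_free_product_Mod amalgam_incl_def
  using hom_compose[OF free_product_incl_hom[of i I A] N.r_coset_hom_Mod] A by (simp add: comp_def)

lemma amalgam_incl_agree:
  assumes "i \<in> I" "j \<in> I" "c \<in> carrier C"
  shows "amalgam_incl I A C \<phi> i (\<phi> i c) = amalgam_incl I A C \<phi> j (\<phi> j c)"
proof -
  let ?N = "normal_closure (free_product I A) (amalgam_relators I A C \<phi>)"
  let ?x = "free_product_incl I A i (\<phi> i c)" and ?y = "free_product_incl I A j (\<phi> j c)"
  have xy: "?x \<in> carrier (free_product I A)" "?y \<in> carrier (free_product I A)"
    using assms free_product_incl_\<phi>_closed by auto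
  have "?x \<otimes>\<^bsub>free_product I A\<^esub> inv\<^bsub>free_product I A\<^esub> ?y \<in> ?N"
    unfolding normal_closure_def amalgam_relators_def using assms by blast
  then have "?x \<in> ?N #>\<^bsub>free_product I A\<^esub> ?y"
    using xy N.rcos_module[OF P.is_group] by blast
  then show ?thesis
    unfolding amalgam_incl_def
    using P.repr_independence[OF _ xy(2) N.subgroup_axioms] by metis
qed

lemma generalized_free_product_generated:
  "carrier (generalized_free_product I A C \<phi>) = generate (generalized_free_product I A C \<phi>)
     (\<Union>i\<in>I. amalgam_incl I A C \<phi> i ` carrier (A i))"
proof -
  let ?N = "normal_closure (free_product I A) (amalgam_relators I A C \<phi>)"
  interpret h: group_hom "free_product I A" "free_product I A Mod ?N" "\<lambda>x. ?N #>\<^bsub>free_product I A\<^esub> x"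
    using N.r_coset_hom_Mod P.is_group N.factorgroup_is_group
    by (simp add: group_hom_def group_hom_axioms_def)
  have "(\<Union>i\<in>I. free_product_incl I A i ` carrier (A i)) \<subseteq> carrier (free_product I A)"
    using free_product_incl_closed by auto
  from h.generate_img[OF this] show ?thesis
    by (simp add: generalized_free_product_Mod carrier_FactGroup free_product_generated[OF A, symmetric]
        image_UN image_image amalgam_incl_def)
qed

text \<open>The maps \<open>f i\<close> combine on the free product; \<open>agree\<close> puts the
  relators into the kernel, which is normal and therefore contains their normal closure.\<close>

lemma generalized_free_product_universal:
  assumes "group H" and f: "\<And>i. i \<in> I \<Longrightarrow> f i \<in> hom (A i) H"
    and agree: "\<And>i j c. i \<in> I \<Longrightarrow> j \<in> I \<Longrightarrow> c \<in> carrier C \<Longrightarrow> f i (\<phi> i c) = f j (\<phi> j c)"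
  obtains h where "h \<in> hom (generalized_free_product I A C \<phi>) H"
    "\<And>i a. i \<in> I \<Longrightarrow> a \<in> carrier (A i) \<Longrightarrow> h (amalgam_incl I A C \<phi> i a) = f i a"
proof -
  let ?N = "normal_closure (free_product I A) (amalgam_relators I A C \<phi>)"
  interpret H: group H by fact
  obtain k where k: "k \<in> hom (free_product I A) H"
    "\<And>i a. i \<in> I \<Longrightarrow> a \<in> carrier (A i) \<Longrightarrow> k (free_product_incl I A i a) = f i a"
    using free_product_universal[of H I f A, OF \<open>group H\<close> f A] by metis
  interpret k: group_hom "free_product I A" H k
    using k(1) by (simp add: group_hom_def group_hom_axioms_def)
  have "k x = \<one>\<^bsub>H\<^esub>" if x: "x \<in> amalgam_relators I A C \<phi>" for x
  proof -
    obtain i j c where ijc: "i \<in> I" "j \<in> I" "c \<in> carrier C"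
      and x: "x = free_product_incl I A i (\<phi> i c) \<otimes>\<^bsub>free_product I A\<^esub>
        inv\<^bsub>free_product I A\<^esub> (free_product_incl I A j (\<phi> j c))"
      using x unfolding amalgam_relators_def by blast
    have "\<phi> i c \<in> carrier (A i)" "\<phi> j c \<in> carrier (A j)" using ijc \<phi> by (meson hom_in_carrier)+
    then show ?thesis
      unfolding x using ijc agree[OF ijc] free_product_incl_\<phi>_closed k(2) hom_in_carrier[OF f]
      by (simp add: H.r_inv)
  qed
  then have "amalgam_relators I A C \<phi> \<subseteq> kernel (free_product I A) H k"
    using amalgam_relators_closed by (auto simp: kernel_def)
  then have "?N \<subseteq> kernel (free_product I A) H k"
    unfolding normal_closure_def using k.normal_kernel by blast
  from k.FactGroup_universal_kernel[OF N.normal_axioms this] obtain h where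
    h: "h \<in> hom (free_product I A Mod ?N) H"
    "\<And>x. x \<in> carrier (free_product I A) \<Longrightarrow> h (?N #>\<^bsub>free_product I A\<^esub> x) = k x" by blast
  show thesis
  proof (rule that)
    show "h \<in> hom (generalized_free_product I A C \<phi>) H"
      using h(1) by (simp add: generalized_free_product_Mod)
    show "h (amalgam_incl I A C \<phi> i a) = f i a" if "i \<in> I" "a \<in> carrier (A i)" for i a
      unfolding amalgam_incl_def using that h(2) k(2) free_product_incl_closed by simp
  qed
qed

end

section \<open>Free groups are residually solvable\<close>

definition perm_group :: "('x \<Rightarrow> 'x) monoid" where
  "perm_group = \<lparr>carrier = {u. bij u}, monoid.mult = (\<circ>), one = id\<rparr>"

lemma perm_group_simps [simp]:
  "carrier perm_group = {u. bij u}" "u \<otimes>\<^bsub>perm_group\<^esub> v = u \<circ> v" "\<one>\<^bsub>perm_group\<^esub> = id"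
  by (simp_all add: perm_group_def)

lemma group_perm_group: "group perm_group"
proof (rule groupI)
  show "\<exists>v \<in> carrier perm_group. v \<otimes>\<^bsub>perm_group\<^esub> u = \<one>\<^bsub>perm_group\<^esub>"
    if "u \<in> carrier perm_group" for u :: "'x \<Rightarrow> 'x"
    using that by (intro bexI[of _ "inv_into UNIV u"]) (simp_all add: bij_imp_bij_inv bij_is_inj)
qed (auto intro: bij_comp simp: o_assoc)

interpretation perm: group perm_group
  by (rule group_perm_group)

lemma inv_perm_group: "bij u \<Longrightarrow> v \<circ> u = id \<Longrightarrow> bij v \<Longrightarrow> inv\<^bsub>perm_group\<^esub> u = v"
  by (intro perm.inv_equality) auto

definition vanishing_below :: "nat \<Rightarrow> (nat \<Rightarrow> int) set" where
  "vanishing_below j = {f. \<forall>k<j. f k = 0}"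

text \<open>Operators \<open>1 + d\<close> where \<open>d\<close> raises the filtration
  \<open>vanishing_below\<close> by \<open>k\<close>; for \<open>k > 0\<close> these are the
  infinite lower unitriangular integer matrices whose first \<open>k - 1\<close> subdiagonals
  vanish. Additivity is stated through differences, which yields it for sums and for zero
  too.\<close>

definition unitriangular :: "nat \<Rightarrow> ((nat \<Rightarrow> int) \<Rightarrow> nat \<Rightarrow> int) set" where
  "unitriangular k = {u. bij u \<and> (\<forall>f g. u (\<lambda>i. f i - g i) = (\<lambda>i. u f i - u g i)) \<and>
     (\<forall>j. \<forall>f \<in> vanishing_below j. (\<lambda>i. u f i - f i) \<in> vanishing_below (j + k))}"

lemma unitriangular_diff: "u \<in> unitriangular k \<Longrightarrow> u (\<lambda>i. f i - g i) = (\<lambda>i. u f i - u g i)"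
  by (simp add: unitriangular_def)

lemma unitriangularD:
  "u \<in> unitriangular k \<Longrightarrow> f \<in> vanishing_below j \<Longrightarrow> (\<lambda>i. u f i - f i) \<in> vanishing_below (j + k)"
  by (simp add: unitriangular_def)

lemma unitriangular_vanishing:
  "u \<in> unitriangular k \<Longrightarrow> f \<in> vanishing_below j \<Longrightarrow> u f \<in> vanishing_below j"
  using unitriangularD[of u k f j] by (auto simp: vanishing_below_def)

lemma subgroup_unitriangular:
  assumes "0 < k"
  shows "subgroup (unitriangular k) perm_group"
proof (rule perm.subgroupI)
  show "unitriangular k \<subseteq> carrier perm_group" by (auto simp: unitriangular_def)
  have "id \<in> unitriangular k" by (simp add: unitriangular_def vanishing_below_def)
  then show "unitriangular k \<noteq> {}" by blast
  show "u \<otimes>\<^bsub>perm_group\<^esub> v \<in> unitriangular k"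
    if u: "u \<in> unitriangular k" and v: "v \<in> unitriangular k" for u v
  proof -
    have "(\<lambda>i. u (v f) i - f i) \<in> vanishing_below (j + k)" if f: "f \<in> vanishing_below j" for f j
      using unitriangularD[OF u unitriangular_vanishing[OF v f]] unitriangularD[OF v f]
      by (auto simp: vanishing_below_def)
    moreover have "bij (u \<circ> v)" using u v by (auto simp: unitriangular_def intro: bij_comp)
    moreover have "u (v (\<lambda>i. f i - g i)) = (\<lambda>i. u (v f) i - u (v g) i)" for f g
      using unitriangular_diff[OF u] unitriangular_diff[OF v] by simp
    ultimately show ?thesis by (simp add: unitriangular_def)
  qed
  show "inv\<^bsub>perm_group\<^esub> u \<in> unitriangular k" if u: "u \<in> unitriangular k" for u
  proof -
    define v where "v = inv_into UNIV u"
    have bij: "bij u" "bij v" using u by (auto simp: unitriangular_def v_def bij_imp_bij_inv)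
    have uv: "u (v f) = f" and vu: "v (u f) = f" for f
      using bij(1) by (simp_all add: v_def bij_is_surj surj_f_inv_f bij_is_inj)
    have "v (\<lambda>i. f i - g i) = (\<lambda>i. v f i - v g i)" for f g
      using unitriangular_diff[OF u, of "v f" "v g"] vu[of "\<lambda>i. v f i - v g i"] by (simp add: uv)
    moreover have "(\<lambda>i. v f i - f i) \<in> vanishing_below (j + k)" if f: "f \<in> vanishing_below j" for f j
    proof -
      \<comment> \<open>\<open>v f\<close> is shown to vanish one entry at a time: once it vanishes
        below \<open>i\<close>, \<open>u\<close> does not change its entry \<open>i\<close> because
        \<open>0 < k\<close>, and \<open>u (v f) = f\<close> is zero there.\<close>
      have "i \<le> j \<Longrightarrow> v f \<in> vanishing_below i" for i
      proof (induction i)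
        case (Suc i)
        then have "(\<lambda>l. u (v f) l - v f l) \<in> vanishing_below (i + k)"
          by (intro unitriangularD[OF u]) simp
        with \<open>0 < k\<close> have "f i = v f i" by (simp add: vanishing_below_def uv)
        with Suc f show ?case by (auto simp: vanishing_below_def less_Suc_eq)
      qed (simp add: vanishing_below_def)
      then have "v f \<in> vanishing_below j" by simp
      from unitriangularD[OF u this] show ?thesis by (simp add: vanishing_below_def uv)
    qed
    ultimately have "v \<in> unitriangular k" using bij by (simp add: unitriangular_def)
    moreover have "inv\<^bsub>perm_group\<^esub> u = v" using bij vu by (intro inv_perm_group) auto
    ultimately show ?thesis by simp
  qed
qed

text \<open>If \<open>h\<close> is obtained from \<open>f\<close> by the two inverses, then
  \<open>f = v (u h)\<close> and the commutator sends \<open>f\<close> to \<open>u (v h)\<close>.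
  The difference is the Lie bracket of \<open>u - 1\<close> and \<open>v - 1\<close> applied to
  \<open>h\<close>, which raises the filtration by \<open>2 k\<close>, hence by
  \<open>Suc k\<close>.\<close>

lemma unitriangular_commutator:
  assumes "0 < k" and u: "u \<in> unitriangular k" and v: "v \<in> unitriangular k"
  shows "u \<otimes>\<^bsub>perm_group\<^esub> v \<otimes>\<^bsub>perm_group\<^esub> inv\<^bsub>perm_group\<^esub> u \<otimes>\<^bsub>perm_group\<^esub> inv\<^bsub>perm_group\<^esub> v
    \<in> unitriangular (Suc k)" (is "?w \<in> _")
proof -
  let ?u = "inv\<^bsub>perm_group\<^esub> u" and ?v = "inv\<^bsub>perm_group\<^esub> v"
  note sub = subgroup_unitriangular[OF \<open>0 < k\<close>]
  have inv: "?u \<in> unitriangular k" "?v \<in> unitriangular k"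
    using u v by (auto intro: subgroup.m_inv_closed[OF sub])
  have w: "?w \<in> unitriangular k"
    using u v inv by (intro subgroup.m_closed[OF sub])
  have bij: "u \<in> carrier perm_group" "v \<in> carrier perm_group"
    using u v by (auto simp: unitriangular_def)
  have "(\<lambda>i. ?w f i - f i) \<in> vanishing_below (j + Suc k)" if f: "f \<in> vanishing_below j" for f j
  proof -
    define h where "h = ?u (?v f)"
    have h: "h \<in> vanishing_below j"
      unfolding h_def by (rule unitriangular_vanishing[OF inv(1) unitriangular_vanishing[OF inv(2) f]])
    have "(v \<otimes>\<^bsub>perm_group\<^esub> (u \<otimes>\<^bsub>perm_group\<^esub> ?u) \<otimes>\<^bsub>perm_group\<^esub> ?v) f = f"
      using bij by (simp del: perm_group_simps add: perm.r_inv) simp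
    then have f_eq: "v (u h) = f" by (simp add: h_def)
    define p q where "p = (\<lambda>i. v h i - h i)" and "q = (\<lambda>i. u h i - h i)"
    have "(\<lambda>i. u p i - p i) \<in> vanishing_below (j + k + k)" "(\<lambda>i. v q i - q i) \<in> vanishing_below (j + k + k)"
      using unitriangularD[OF u h] unitriangularD[OF v h]
      by (auto simp: p_def q_def intro: unitriangularD[OF u] unitriangularD[OF v])
    moreover have "u p i = u (v h) i - u h i" "v q i = f i - v h i" for i
      by (simp_all add: p_def q_def unitriangular_diff[OF u] unitriangular_diff[OF v] f_eq)
    ultimately have "u (v h) i = f i" if "i < j + k + k" for i
      using that by (fastforce simp: vanishing_below_def p_def q_def)
    with \<open>0 < k\<close> show ?thesis by (simp add: vanishing_below_def h_def)
  qed
  with w show ?thesis unfolding unitriangular_def by simp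
qed

lemma derived_unitriangular:
  "(derived perm_group ^^ n) (unitriangular 1) \<subseteq> unitriangular (Suc n)"
proof (induction n)
  case (Suc n)
  have "(derived perm_group ^^ Suc n) (unitriangular 1) \<subseteq> derived perm_group (unitriangular (Suc n))"
    using perm.mono_derived[OF Suc] by simp
  also have "\<dots> \<subseteq> unitriangular (Suc (Suc n))"
    unfolding derived_def
    using unitriangular_commutator[of "Suc n"]
    by (intro perm.generate_subgroup_incl subgroup_unitriangular) auto
  finally show ?case .
qed simp

text \<open>An entry \<open>m\<close> moved by \<open>h w\<close> determines the index: the
  \<open>m\<close>-th derived subgroup acts through \<open>unitriangular (Suc m)\<close> and so
  fixes the entries \<open>0\<close> to \<open>m\<close> of every sequence, as every sequence lies
  in \<open>vanishing_below 0\<close>.\<close>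

lemma (in group) notin_derived_if_unitriangular:
  assumes h: "h \<in> hom G perm_group" "h ` carrier G \<subseteq> unitriangular 1"
    and w: "w \<in> carrier G" "h w \<noteq> id"
  shows "\<exists>n. w \<notin> (derived G ^^ n) (carrier G)"
proof -
  interpret h: group_hom G perm_group h
    using h(1) by unfold_locales
  obtain f m where fm: "h w f m \<noteq> f m"
    using w(2) by (metis eq_id_iff ext)
  have "w \<notin> (derived G ^^ m) (carrier G)"
  proof
    assume "w \<in> (derived G ^^ m) (carrier G)"
    then have "h w \<in> (derived perm_group ^^ m) (h ` carrier G)"
      by (simp add: h.exp_of_derived_img)
    then have "h w \<in> unitriangular (Suc m)"
      using perm.mono_exp_of_derived[OF h(2)] derived_unitriangular by blast
    then have "(\<lambda>i. h w f i - f i) \<in> vanishing_below (0 + Suc m)"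
      by (rule unitriangularD) (simp add: vanishing_below_def)
    with fm show False by (simp add: vanishing_below_def)
  qed
  then show ?thesis by blast
qed

text \<open>A shortest expression as a product of powers of generators has these properties: a zero
  exponent could be dropped, and two neighbouring powers of the same generator could be
  merged.\<close>

lemma free_group_syllables:
  assumes "w \<in> carrier (free_group S)"
  obtains L where "L \<in> lists (S \<times> UNIV)"
    "w = word_value (free_group S) (\<lambda>(s, e :: int). free_gen S s [^]\<^bsub>free_group S\<^esub> e) L"
    "\<And>k. k < length L \<Longrightarrow> snd (L ! k) \<noteq> 0"
    "\<And>k. Suc k < length L \<Longrightarrow> fst (L ! k) \<noteq> fst (L ! Suc k)"
proof -
  interpret F: group "free_group S" by (rule group_free_group)
  let ?g = "\<lambda>(s, e :: int). free_gen S s [^]\<^bsub>free_group S\<^esub> e"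
  let ?val = "word_value (free_group S) ?g" and ?L = "lists (S \<times> (UNIV :: int set))"
  have g: "?g \<in> S \<times> UNIV \<rightarrow> carrier (free_group S)" by (auto intro: free_gen_closed)
  have gen: "free_gen S s \<in> carrier (free_group S)" if "s \<in> S" for s using that by (rule free_gen_closed)
  have "w \<in> generate (free_group S) (free_gen S ` S)"
    using assms by (simp add: free_group_generated)
  then have "\<exists>L. L \<in> ?L \<and> ?val L = w"
  proof (induction rule: generate.induct)
    case one
    show ?case by (intro exI[of _ "[]"]) simp
  next
    case (incl h)
    then obtain s where "s \<in> S" "h = free_gen S s" by blast
    then show ?case using gen by (intro exI[of _ "[(s, 1)]"]) simp
  next
    case (inv h)
    then obtain s where "s \<in> S" "h = free_gen S s" by blast
    then show ?case using gen by (intro exI[of _ "[(s, -1)]"]) (simp add: F.int_pow_neg)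
  next
    case (eng h1 h2)
    then obtain L1 L2 where "L1 \<in> ?L" "?val L1 = h1" "L2 \<in> ?L" "?val L2 = h2" by blast
    then show ?case
      using F.word_value_append[OF g] by (intro exI[of _ "L1 @ L2"]) auto
  qed
  then obtain L where L: "L \<in> ?L" "?val L = w"
    and min: "\<And>M. M \<in> ?L \<and> ?val M = w \<Longrightarrow> length L \<le> length M"
    using ex_has_least_nat[of "\<lambda>L. L \<in> ?L \<and> ?val L = w" _ length] by metis
  have val: "?val (P @ x # Q) = ?val P \<otimes>\<^bsub>free_group S\<^esub> (?g x \<otimes>\<^bsub>free_group S\<^esub> ?val Q)"
    if "P \<in> ?L" "Q \<in> ?L" "x \<in> S \<times> UNIV" for P Q x
    using F.word_value_append[OF g that(1), of "x # Q"] that by simp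
  show thesis
  proof (rule that[OF L(1) L(2)[symmetric]])
    fix k assume k: "k < length L"
    show "snd (L ! k) \<noteq> 0"
    proof
      assume 0: "snd (L ! k) = 0"
      let ?P = "take k L" and ?Q = "drop (Suc k) L"
      obtain s where s: "L ! k = (s, 0)" using 0 by (metis prod.collapse)
      have Leq: "L = ?P @ (s, 0) # ?Q" using id_take_nth_drop[OF k] s by simp
      have PQ: "?P \<in> ?L" "?Q \<in> ?L" "s \<in> S" using L(1) s k nth_mem[OF k]
        by (auto dest: in_set_takeD in_set_dropD)
      have "?val (?P @ ?Q) = w"
        using val[OF PQ(1,2), of "(s, 0)"] F.word_value_append[OF g PQ(1,2)]
          F.word_value_closed[OF g PQ(2)] PQ(3) L(2) Leq by simp
      then show False using min[of "?P @ ?Q"] PQ k by simp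
    qed
  next
    fix k assume k: "Suc k < length L"
    show "fst (L ! k) \<noteq> fst (L ! Suc k)"
    proof
      assume eq: "fst (L ! k) = fst (L ! Suc k)"
      let ?P = "take k L" and ?Q = "drop (Suc (Suc k)) L"
      obtain s e e' where s: "L ! k = (s, e)" "L ! Suc k = (s, e')" using eq by (metis prod.collapse)
      have Leq: "L = ?P @ (s, e) # (s, e') # ?Q"
        using id_take_nth_drop[of k L] Cons_nth_drop_Suc[of "Suc k" L] s k by simp
      have PQ: "?P \<in> ?L" "?Q \<in> ?L" "s \<in> S" using L(1) s k nth_mem[of k L]
        by (auto dest: in_set_takeD in_set_dropD)
      have "?val (?P @ (s, e + e') # ?Q) = w"
        using val[OF PQ(1), of "(s, e') # ?Q" "(s, e)"] val[OF PQ(1,2), of "(s, e + e')"]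
          F.word_value_closed[OF g PQ(2)] PQ L(2) Leq
        by (simp add: F.int_pow_mult F.m_assoc gen)
      then show False using min[of "?P @ (s, e + e') # ?Q"] PQ k by simp
    qed
  qed
qed

text \<open>If adjacent values of \<open>\<sigma>\<close> differ then \<open>shift n \<sigma> s 1\<close> is the identity plus an operator of
  square zero, so that its \<open>e\<close>-th power is \<open>shift n \<sigma> s e\<close>.\<close>

definition shift :: "nat \<Rightarrow> (nat \<Rightarrow> 's) \<Rightarrow> 's \<Rightarrow> int \<Rightarrow> (nat \<Rightarrow> int) \<Rightarrow> nat \<Rightarrow> int" where
  "shift n \<sigma> s e f k =
     f k + (case k of 0 \<Rightarrow> 0 | Suc l \<Rightarrow> if l < n \<and> \<sigma> l = s then e * f l else 0)"

context
  fixes n :: nat and \<sigma> :: "nat \<Rightarrow> 's"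
  assumes adjacent: "\<And>k. Suc k < n \<Longrightarrow> \<sigma> k \<noteq> \<sigma> (Suc k)"
begin

lemma shift_shift: "shift n \<sigma> s e \<circ> shift n \<sigma> s e' = shift n \<sigma> s (e + e')"
proof -
  have "shift n \<sigma> s e (shift n \<sigma> s e' f) k = shift n \<sigma> s (e + e') f k" for f k
  proof (cases k)
    \<comment> \<open>The only term quadratic in the exponents comes from entry \<open>l - 1\<close>
      and requires \<open>\<sigma> (l - 1) = s = \<sigma> l\<close>, which \<open>adjacent\<close>
      excludes.\<close>
    case (Suc l)
    then show ?thesis
      using adjacent[of "l - 1"] by (cases l) (auto simp: shift_def algebra_simps)
  qed (simp add: shift_def)
  then show ?thesis by (auto simp: fun_eq_iff)
qed

lemma shift_0: "shift n \<sigma> s 0 = id"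
  by (auto simp: fun_eq_iff shift_def split: nat.splits)

lemma bij_shift: "bij (shift n \<sigma> s e)"
  using shift_shift[of s e "- e"] shift_shift[of s "- e" e] by (intro o_bij) (simp_all add: shift_0)

lemma shift_unitriangular: "shift n \<sigma> s e \<in> unitriangular 1"
  unfolding unitriangular_def
  by (auto simp: bij_shift fun_eq_iff vanishing_below_def shift_def algebra_simps split: nat.splits)

lemma shift_nat_pow: "shift n \<sigma> s 1 [^]\<^bsub>perm_group\<^esub> (m :: nat) = shift n \<sigma> s (int m)"
  by (induction m) (simp_all add: shift_0 shift_shift add.commute)

lemma shift_int_pow: "shift n \<sigma> s 1 [^]\<^bsub>perm_group\<^esub> (e :: int) = shift n \<sigma> s e"
proof -
  have "inv\<^bsub>perm_group\<^esub> shift n \<sigma> s e = shift n \<sigma> s (- e)" for e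
    using shift_shift[of s "- e" e] by (intro inv_perm_group bij_shift) (simp add: shift_0)
  then show ?thesis by (simp add: int_pow_def2 shift_nat_pow)
qed

end

theorem free_group_notin_derived:
  assumes w: "w \<in> carrier (free_group S)" "w \<noteq> \<one>\<^bsub>free_group S\<^esub>"
  shows "\<exists>n. w \<notin> (derived (free_group S) ^^ n) (carrier (free_group S))"
proof -
  interpret F: group "free_group S" by (rule group_free_group)
  let ?g = "\<lambda>(s, e :: int). free_gen S s [^]\<^bsub>free_group S\<^esub> e"
  obtain L where L: "L \<in> lists (S \<times> UNIV)" "w = word_value (free_group S) ?g L"
    and nz: "\<And>k. k < length L \<Longrightarrow> snd (L ! k) \<noteq> 0"
    and adj: "\<And>k. Suc k < length L \<Longrightarrow> fst (L ! k) \<noteq> fst (L ! Suc k)"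
    by (rule free_group_syllables[OF w(1)]) (rule that)
  define n where "n = length L"
  \<comment> \<open>Syllables are numbered from the right because the rightmost one acts first:
    syllable \<open>j\<close> is to carry entry \<open>j\<close> into entry
    \<open>Suc j\<close>.\<close>
  define \<sigma> where "\<sigma> k = fst (L ! (n - Suc k))" for k
  have adjacent: "\<sigma> k \<noteq> \<sigma> (Suc k)" if "Suc k < n" for k
  proof -
    have "Suc (n - Suc (Suc k)) = n - Suc k" "n - Suc k < n" using that by auto
    then show ?thesis using adj[of "n - Suc (Suc k)"] by (simp add: \<sigma>_def n_def)
  qed
  note shift = bij_shift[of n \<sigma>, OF adjacent] shift_unitriangular[of n \<sigma>, OF adjacent]
    shift_int_pow[of n \<sigma>, OF adjacent]
  have "(\<lambda>s. shift n \<sigma> s 1) \<in> S \<rightarrow> carrier perm_group" using shift(1) by simp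
  from free_group_universal[OF group_perm_group this] obtain h where
    h: "h \<in> hom (free_group S) perm_group" "\<And>s. s \<in> S \<Longrightarrow> h (free_gen S s) = shift n \<sigma> s 1"
    by blast
  interpret h: group_hom "free_group S" perm_group h
    using h(1) by unfold_locales
  have gens: "free_gen S ` S \<subseteq> carrier (free_group S)" by (auto intro: free_gen_closed)
  have "h ` free_gen S ` S \<subseteq> unitriangular 1" using h(2) shift(2) by auto
  then have img: "h ` carrier (free_group S) \<subseteq> unitriangular 1"
    using h.generate_img[OF gens] perm.generate_subgroup_incl[OF _ subgroup_unitriangular[of 1]]
    by (metis free_group_generated zero_less_one)
  have hg: "h (?g (s, e)) = shift n \<sigma> s e" if "s \<in> S" for s e
    using that h.hom_int_pow[OF free_gen_closed[OF that]] h(2) shift(3) by simp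
  have g: "?g \<in> S \<times> UNIV \<rightarrow> carrier (free_group S)" by (auto intro: free_gen_closed)
  define \<delta> :: "nat \<Rightarrow> int" where "\<delta> k = (if k = 0 then 1 else 0)" for k
  \<comment> \<open>The last \<open>j\<close> syllables take the unit vector \<open>\<delta>\<close>
    to a sequence whose last nonzero entry is at \<open>j\<close>, namely the product of their
    exponents. The next syllable carries it to \<open>Suc j\<close>; nothing further out is reached,
    since each shift moves entries by one place only.\<close>
  have "j \<le> n \<Longrightarrow> h (word_value (free_group S) ?g (drop (n - j) L)) \<delta> j \<noteq> 0 \<and>
      (\<forall>k>j. h (word_value (free_group S) ?g (drop (n - j) L)) \<delta> k = 0)" for j
  proof (induction j)
    case 0
    then show ?case by (simp add: n_def \<delta>_def)
  next
    case (Suc j)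
    let ?x = "\<lambda>j. word_value (free_group S) ?g (drop (n - j) L)"
    obtain s e where se: "L ! (n - Suc j) = (s, e)" by (cases "L ! (n - Suc j)")
    have drop: "drop (n - Suc j) L = (s, e) # drop (n - j) L"
      using Suc.prems Cons_nth_drop_Suc[of "n - Suc j" L] se by (simp add: n_def Suc_diff_Suc)
    have "n - Suc j < length L" using Suc.prems by (simp add: n_def)
    then have "(s, e) \<in> set L" using nth_mem se by metis
    then have mem: "s \<in> S" "drop (n - j) L \<in> lists (S \<times> UNIV)"
      using L(1) by (auto dest: in_set_dropD)
    have "h (?x (Suc j)) = h (?g (s, e)) \<circ> h (?x j)"
      unfolding drop using F.word_value_closed[OF g mem(2)] funcset_mem[OF g, of "(s, e)"] mem(1)
      by simp
    then have "h (?x (Suc j)) \<delta> k = shift n \<sigma> s e (h (?x j) \<delta>) k" for k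
      by (simp only: hg[OF mem(1)] comp_apply)
    moreover have "\<sigma> j = s" "e \<noteq> 0" "j < n"
      using se nz[of "n - Suc j"] Suc.prems by (auto simp: \<sigma>_def n_def)
    ultimately show ?case
      using Suc by (auto simp: shift_def split: nat.splits)
  qed
  from this[of n] have "h w \<delta> n \<noteq> 0" by (simp add: L(2))
  moreover have "\<delta> n = 0" using w(2) L(2) by (auto simp: \<delta>_def n_def)
  ultimately have "h w \<noteq> id" by auto
  with F.notin_derived_if_unitriangular[OF h(1) img w(1)] show ?thesis .
qed

section \<open>Commutators and lower central series\<close>

lemma (in group) commute_generate:
  assumes "T \<subseteq> carrier G" "y \<in> carrier G" "\<And>x. x \<in> T \<Longrightarrow> x \<otimes> y = y \<otimes> x" "x \<in> generate G T"
  shows "x \<otimes> y = y \<otimes> x"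
  using assms(4)
proof (induction rule: generate.induct)
  case (inv h)
  with assms have "h \<in> carrier G" "h \<otimes> y = y \<otimes> h" by auto
  with assms(2) show ?case by (metis inv_closed inv_solve_left inv_solve_right m_assoc m_closed)
next
  case (eng h1 h2)
  have "h1 \<in> carrier G" "h2 \<in> carrier G" using generate_in_carrier[OF assms(1)] eng by auto
  with eng assms(2) show ?case by (metis m_assoc)
qed (use assms in auto)

lemma (in group) commute_generate_generate:
  assumes T: "T \<subseteq> carrier G" and U: "U \<subseteq> carrier G"
    and comm: "\<And>x y. x \<in> T \<Longrightarrow> y \<in> U \<Longrightarrow> x \<otimes> y = y \<otimes> x"
    and "x \<in> generate G T" "y \<in> generate G U"
  shows "x \<otimes> y = y \<otimes> x"
proof (rule commute_generate[OF T _ _ assms(4)])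
  show "y \<in> carrier G" using generate_in_carrier[OF U] assms(5) .
  show "x \<otimes> y = y \<otimes> x" if "x \<in> T" for x
    using commute_generate[OF U _ _ assms(5), of x] comm that T by (metis subsetD)
qed

text \<open>This translates between commutators in a normal subgroup and commuting in the quotient,
  where commuting extends from generators to the subgroups they generate.\<close>

lemma (in normal) commutator_mem_iff:
  assumes "x \<in> carrier G" "y \<in> carrier G"
  shows "x \<otimes> y \<otimes> inv x \<otimes> inv y \<in> H \<longleftrightarrow> (H #> x) <#> (H #> y) = (H #> y) <#> (H #> x)"
proof -
  have "x \<otimes> y \<otimes> inv x \<otimes> inv y = (x \<otimes> y) \<otimes> inv (y \<otimes> x)"
    using assms by (simp add: inv_mult_group m_assoc)
  moreover have "(x \<otimes> y) \<otimes> inv (y \<otimes> x) \<in> H \<longleftrightarrow> x \<otimes> y \<in> H #> (y \<otimes> x)"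
    using assms rcos_module[OF is_group] by simp
  moreover have "\<dots> \<longleftrightarrow> H #> (x \<otimes> y) = H #> (y \<otimes> x)"
    using assms repr_independence[OF _ _ subgroup_axioms] rcos_self[OF _ subgroup_axioms]
    by (metis m_closed)
  ultimately show ?thesis using assms by (simp add: rcos_sum)
qed

lemma (in group) lower_central_series_normal: "lower_central_series G n \<lhd> G"
proof (induction n)
  case 0
  show ?case by (simp add: normal_self)
next
  case (Suc n)
  interpret L: normal "lower_central_series G n" G by (rule Suc)
  let ?C = "{x \<otimes> y \<otimes> inv x \<otimes> inv y | x y. x \<in> lower_central_series G n \<and> y \<in> carrier G}"
  have "generate G ?C \<lhd> G"
  proof (rule normal_generateI)
    show "?C \<subseteq> carrier G" using L.subset by auto
    fix h g assume "h \<in> ?C" and g: "g \<in> carrier G"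
    then obtain x y where xy: "x \<in> lower_central_series G n" "y \<in> carrier G"
      and h: "h = x \<otimes> y \<otimes> inv x \<otimes> inv y" by blast
    interpret c: group_hom G G "\<lambda>z. g \<otimes> z \<otimes> inv g"
      using g by unfold_locales (auto intro!: homI simp: m_assoc inv_solve_left)
    have "g \<otimes> h \<otimes> inv g = (g \<otimes> x \<otimes> inv g) \<otimes> (g \<otimes> y \<otimes> inv g) \<otimes> inv (g \<otimes> x \<otimes> inv g) \<otimes> inv (g \<otimes> y \<otimes> inv g)"
      unfolding h using xy L.subset by (simp only: c.hom_mult c.hom_inv m_closed inv_closed subsetD)
    moreover have "g \<otimes> x \<otimes> inv g \<in> lower_central_series G n" using xy(1) g by (rule L.inv_op_closed2[rotated])
    ultimately show "g \<otimes> h \<otimes> inv g \<in> ?C" using xy(2) g by blast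
  qed
  then show ?case by simp
qed

lemma (in group) lower_central_series_trivial_mono:
  assumes "lower_central_series G n = {\<one>}" "n \<le> m"
  shows "lower_central_series G m = {\<one>}"
  using assms(2)
proof (induction m rule: dec_induct)
  case (step m)
  let ?C = "{x \<otimes> y \<otimes> inv x \<otimes> inv y | x y. x \<in> lower_central_series G m \<and> y \<in> carrier G}"
  have "x \<otimes> y \<otimes> inv x \<otimes> inv y = \<one>" if "x \<in> lower_central_series G m" "y \<in> carrier G" for x y
    using that by (simp add: step.IH)
  then have "?C \<subseteq> {\<one>}" by blast
  then have "generate G ?C \<subseteq> {\<one>}" by (rule generate_subgroup_incl[OF _ triv_subgroup])
  then show ?case using generate.one[of G ?C] by auto
qed (rule assms(1))

lemma (in group) derived_subset_lower_central_series:
  "(derived G ^^ n) (carrier G) \<subseteq> lower_central_series G n"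
proof (induction n)
  case (Suc n)
  have "derived_set G ((derived G ^^ n) (carrier G))
      \<subseteq> {x \<otimes> y \<otimes> inv x \<otimes> inv y | x y. x \<in> lower_central_series G n \<and> y \<in> carrier G}"
    using Suc exp_of_derived_in_carrier[OF subset_refl, of n] by blast
  from mono_generate[OF this] show ?case
    by (simp add: derived_def[of G "(derived G ^^ n) (carrier G)"])
qed simp

text \<open>By induction, the \<open>k\<close>-th term for \<open>G\<close> lies in the subgroup
  generated by \<open>T k\<close>, the images of the \<open>k\<close>-th terms of the factors. One
  common index \<open>n\<close> for all factors therefore kills the series of
  \<open>G\<close>.\<close>

lemma (in group) lower_central_series_commuting_factors:
  fixes A :: "'i \<Rightarrow> ('d, 'n) monoid_scheme"
  assumes A: "\<And>i. i \<in> I \<Longrightarrow> group (A i)" and f: "\<And>i. i \<in> I \<Longrightarrow> f i \<in> hom (A i) G"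
    and gen: "carrier G = generate G (\<Union>i\<in>I. f i ` carrier (A i))"
    and comm: "\<And>i j a b. i \<in> I \<Longrightarrow> j \<in> I \<Longrightarrow> i \<noteq> j \<Longrightarrow> a \<in> carrier (A i) \<Longrightarrow> b \<in> carrier (A j) \<Longrightarrow>
      f i a \<otimes> f j b = f j b \<otimes> f i a"
    and trivial: "\<And>i. i \<in> I \<Longrightarrow> lower_central_series (A i) n = {\<one>\<^bsub>A i\<^esub>}"
  shows "lower_central_series G n = {\<one>}"
proof -
  define T where "T n = (\<Union>i\<in>I. f i ` lower_central_series (A i) n)" for n
  have hom: "group_hom (A i) G (f i)" if "i \<in> I" for i
    using A[OF that] f[OF that] by (simp add: group_hom_def group_hom_axioms_def is_group)
  have f_closed: "f i a \<in> carrier G" if "i \<in> I" "a \<in> carrier (A i)" for i a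
    using f[OF that(1)] that(2) by (rule hom_in_carrier)
  have lcs: "lower_central_series (A i) k \<subseteq> carrier (A i)" if "i \<in> I" for i k
    using group.lower_central_series_normal[OF A[OF that]] by (metis normal_imp_subgroup subgroup.subset)
  have T: "T k \<subseteq> carrier G" for k
    using f_closed subsetD[OF lcs] by (auto simp: T_def)
  have T_I: "f i a \<in> T k" if "i \<in> I" "a \<in> lower_central_series (A i) k" for i a k
    using that by (auto simp: T_def)
  \<comment> \<open>Already the generating set is invariant, before any subgroup is generated: a
    factor conjugates its own lower central terms into themselves and centralises the images of the
    others.\<close>
  have conj_gen: "f j b \<otimes> x \<otimes> inv (f j b) \<in> T k" if j: "j \<in> I" "b \<in> carrier (A j)" and x: "x \<in> T k" for j b x k
  proof -
    obtain i a where i: "i \<in> I" and a: "a \<in> lower_central_series (A i) k" and x: "x = f i a"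
      using x by (auto simp: T_def)
    then have a': "a \<in> carrier (A i)" using lcs by blast
    show ?thesis
    proof (cases "i = j")
      case True
      interpret fi: group_hom "A i" G "f i" by (rule hom[OF i])
      have "b \<otimes>\<^bsub>A i\<^esub> a \<otimes>\<^bsub>A i\<^esub> inv\<^bsub>A i\<^esub> b \<in> lower_central_series (A i) k"
        using fi.G.normal_invE(2)[OF fi.G.lower_central_series_normal] a j True by simp
      moreover have "f i (b \<otimes>\<^bsub>A i\<^esub> a \<otimes>\<^bsub>A i\<^esub> inv\<^bsub>A i\<^esub> b) = f j b \<otimes> x \<otimes> inv (f j b)"
        using j(2) a' by (simp add: x flip: True)
      ultimately show ?thesis using T_I[OF i] by metis
    next
      case False
      then have "f j b \<otimes> x = x \<otimes> f j b"
        using comm[OF i j(1) _ a' j(2)] by (simp add: x)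
      then have "f j b \<otimes> x \<otimes> inv (f j b) = x"
        using f_closed[OF j] f_closed[OF i a'] by (simp add: x m_assoc)
      then show ?thesis using i a x by (auto simp: T_def)
    qed
  qed
  have conj: "g \<otimes> x \<otimes> inv g \<in> T k" if "g \<in> carrier G" "x \<in> T k" for g x k
  proof -
    have "g \<in> generate G (\<Union>i\<in>I. f i ` carrier (A i))" using that(1) gen by simp
    then have "\<forall>x \<in> T k. g \<otimes> x \<otimes> inv g \<in> T k"
    proof (induction rule: generate.induct)
      case one
      show ?case using T by (auto simp: subset_iff)
    next
      case (incl h)
      then show ?case using conj_gen by auto
    next
      case (inv h)
      then obtain i a where i: "i \<in> I" "a \<in> carrier (A i)" "h = f i a" by auto
      interpret fi: group_hom "A i" G "f i" by (rule hom[OF i(1)])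
      show ?case using conj_gen[OF i(1) fi.G.inv_closed[OF i(2)]] i by simp
    next
      case (eng h1 h2)
      have h: "h1 \<in> carrier G" "h2 \<in> carrier G" using eng gen by auto
      have "h1 \<otimes> h2 \<otimes> x \<otimes> inv (h1 \<otimes> h2) = h1 \<otimes> (h2 \<otimes> x \<otimes> inv h2) \<otimes> inv h1" if "x \<in> T k" for x
        using h that T[of k] by (simp add: inv_mult_group m_assoc subset_iff)
      with eng show ?case by simp
    qed
    with that show ?thesis by blast
  qed
  have "lower_central_series G k \<subseteq> generate G (T k)" for k
  proof (induction k)
    case 0
    then show ?case using gen by (simp add: T_def)
  next
    case (Suc k)
    \<comment> \<open>Modulo \<open>?N\<close> the elements of \<open>T k\<close> commute with all
      generators: within one factor the commutator is an element of \<open>T (Suc k)\<close>, and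
      between different factors it is trivial. Passing to the quotient replaces commutator
      identities for products.\<close>
    let ?N = "generate G (T (Suc k))"
    interpret N: normal ?N G by (rule normal_generateI[OF T conj])
    interpret \<pi>: group_hom G "G Mod ?N" "\<lambda>x. ?N #> x"
      using N.r_coset_hom_Mod N.factorgroup_is_group by (simp add: group_hom_def group_hom_axioms_def is_group)
    let ?B = "\<Union>i\<in>I. f i ` carrier (A i)"
    have B: "?B \<subseteq> carrier G" using f_closed by auto
    have gens: "(?N #> x) \<otimes>\<^bsub>G Mod ?N\<^esub> (?N #> y) = (?N #> y) \<otimes>\<^bsub>G Mod ?N\<^esub> (?N #> x)"
      if x: "x \<in> T k" and y: "y \<in> ?B" for x y
    proof -
      obtain i a where i: "i \<in> I" and a: "a \<in> lower_central_series (A i) k" and xa: "x = f i a"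
        using x by (auto simp: T_def)
      obtain j b where j: "j \<in> I" "b \<in> carrier (A j)" and yb: "y = f j b"
        using y by auto
      have a': "a \<in> carrier (A i)" using i a lcs by blast
      have xy: "x \<in> carrier G" "y \<in> carrier G" using i a' j f_closed xa yb by auto
      have "x \<otimes> y \<otimes> inv x \<otimes> inv y \<in> ?N"
      proof (cases "i = j")
        case True
        interpret fi: group_hom "A i" G "f i" by (rule hom[OF i])
        have "a \<otimes>\<^bsub>A i\<^esub> b \<otimes>\<^bsub>A i\<^esub> inv\<^bsub>A i\<^esub> a \<otimes>\<^bsub>A i\<^esub> inv\<^bsub>A i\<^esub> b \<in> lower_central_series (A i) (Suc k)"
          using a j True by (auto intro!: generate.incl)
        moreover have "f i (a \<otimes>\<^bsub>A i\<^esub> b \<otimes>\<^bsub>A i\<^esub> inv\<^bsub>A i\<^esub> a \<otimes>\<^bsub>A i\<^esub> inv\<^bsub>A i\<^esub> b) = x \<otimes> y \<otimes> inv x \<otimes> inv y"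
          using j(2) a' by (simp add: xa yb flip: True)
        ultimately have "x \<otimes> y \<otimes> inv x \<otimes> inv y \<in> T (Suc k)"
          using T_I[OF i] by metis
        then show ?thesis by (rule generate.incl)
      next
        case False
        then have "x \<otimes> y = y \<otimes> x" using comm[OF i j(1) _ a' j(2)] by (simp add: xa yb)
        then have "x \<otimes> y \<otimes> inv x \<otimes> inv y = \<one>" using xy by (simp add: m_assoc)
        then show ?thesis by (simp add: generate.one)
      qed
      then show ?thesis using N.commutator_mem_iff[OF xy] by simp
    qed
    have "x \<otimes> y \<otimes> inv x \<otimes> inv y \<in> ?N" if x: "x \<in> lower_central_series G k" and y: "y \<in> carrier G" for x y
    proof -
      have x': "x \<in> generate G (T k)" using x Suc by blast
      then have "x \<in> carrier G" using generate_in_carrier[OF T] by blast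
      have "(?N #> x) \<otimes>\<^bsub>G Mod ?N\<^esub> (?N #> y) = (?N #> y) \<otimes>\<^bsub>G Mod ?N\<^esub> (?N #> x)"
      proof (rule \<pi>.H.commute_generate_generate)
        show "(#>) ?N ` T k \<subseteq> carrier (G Mod ?N)" "(#>) ?N ` ?B \<subseteq> carrier (G Mod ?N)"
          using T B \<pi>.hom_closed by blast+
        show "?N #> x \<in> generate (G Mod ?N) ((#>) ?N ` T k)" "?N #> y \<in> generate (G Mod ?N) ((#>) ?N ` ?B)"
          using \<pi>.generate_img[OF T] \<pi>.generate_img[OF B] x' y gen by auto
      qed (use gens in blast)
      then show ?thesis using N.commutator_mem_iff[OF \<open>x \<in> carrier G\<close> y] by simp
    qed
    then show ?case
      by (simp del: mult_FactGroup) (intro generate_subgroup_incl N.subgroup_axioms, blast)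
  qed
  moreover have "T n \<subseteq> {\<one>}"
    using trivial group_hom.hom_one[OF hom] by (auto simp: T_def)
  then have "generate G (T n) \<subseteq> {\<one>}" by (rule generate_subgroup_incl[OF _ triv_subgroup])
  ultimately show ?thesis
    using subgroup.one_closed[OF normal_imp_subgroup[OF lower_central_series_normal]] by blast
qed

text \<open>The solvable image is the quotient by the term of the derived series that misses
  \<open>g\<close>; its own derived series is the image of that of \<open>G\<close> and ends after
  \<open>n\<close> steps.\<close>

lemma (in group) residually_solvableI:
  assumes "\<And>g. g \<in> carrier G \<Longrightarrow> g \<noteq> \<one> \<Longrightarrow> \<exists>n. g \<notin> (derived G ^^ n) (carrier G)"
  shows "residually_solvable G"
  unfolding residually_solvable_def
proof (intro conjI ballI impI is_group)
  fix g assume g: "g \<in> carrier G" "g \<noteq> \<one>"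
  then obtain n where n: "g \<notin> (derived G ^^ n) (carrier G)" using assms by blast
  let ?L = "(derived G ^^ n) (carrier G)"
  have "?L \<lhd> G" by (induction n) (simp_all add: normal_self derived_is_normal)
  then interpret L: normal ?L G .
  interpret \<pi>: group_hom G "G Mod ?L" "\<lambda>x. ?L #> x"
    using L.r_coset_hom_Mod L.factorgroup_is_group by (simp add: group_hom_def group_hom_axioms_def is_group)
  have "(derived (G Mod ?L) ^^ n) ((\<lambda>x. ?L #> x) ` carrier G) = (\<lambda>x. ?L #> x) ` ?L"
    by (rule \<pi>.exp_of_derived_img) simp
  also have "\<dots> = {?L}" using L.rcos_const[OF is_group] L.one_closed by blast
  finally have "solvable (G Mod ?L)"
    using \<pi>.H.solvable_iff_trivial_derived_seq by (auto simp: carrier_FactGroup)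
  moreover have "(\<lambda>x. ?L #> x) \<in> epi G (G Mod ?L)"
    using L.r_coset_hom_Mod by (simp add: epi_def carrier_FactGroup)
  moreover have "?L #> g \<noteq> \<one>\<^bsub>G Mod ?L\<^esub>"
    using n coset_join1[OF _ g(1) L.subgroup_axioms] by auto
  ultimately show "\<exists>(H :: 'a set monoid) h. group H \<and> solvable H \<and> h \<in> epi G H \<and> h g \<noteq> \<one>\<^bsub>H\<^esub>"
    using L.factorgroup_is_group by blast
qed

text \<open>The nilpotent quotient forces the derived series of \<open>G\<close> into
  \<open>K\<close> after \<open>n\<close> steps, and from then on it stays below the derived series
  of \<open>K\<close>, which \<open>\<beta>\<close> transports from the free group. An element of
  \<open>K\<close> missed at step \<open>m\<close> there is missed at step \<open>m + n\<close> in
  \<open>G\<close>.\<close>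

lemma (in group) free_by_nilpotent_residually_solvable:
  assumes "K \<lhd> G" "nilpotent_group (G Mod K)"
    and \<beta>: "\<beta> \<in> iso (free_group S) (G\<lparr>carrier := K\<rparr>)"
  shows "residually_solvable G"
proof -
  interpret K: normal K G by fact
  obtain n where n: "lower_central_series (G Mod K) n = {\<one>\<^bsub>G Mod K\<^esub>}"
    using assms(2) by (auto simp: nilpotent_group_def)
  interpret \<pi>: group_hom G "G Mod K" "\<lambda>x. K #> x"
    using K.r_coset_hom_Mod K.factorgroup_is_group by (simp add: group_hom_def group_hom_axioms_def)
  interpret F: group "free_group S" by (rule group_free_group)
  have inj: "inj_on \<beta> (carrier (free_group S))" and img: "\<beta> ` carrier (free_group S) = K"
    using \<beta> by (auto simp: iso_def bij_betw_def)
  interpret \<beta>: group_hom "free_group S" G \<beta>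
    using \<beta> K.subset by unfold_locales (auto simp: iso_def hom_def)
  have dK: "(derived G ^^ n) (carrier G) \<subseteq> K"
  proof
    fix g assume g: "g \<in> (derived G ^^ n) (carrier G)"
    then have "K #> g \<in> (derived (G Mod K) ^^ n) (carrier (G Mod K))"
      by (simp add: carrier_FactGroup \<pi>.exp_of_derived_img)
    then have "K #> g = K" using \<pi>.H.derived_subset_lower_central_series[of n] n by auto
    then show "g \<in> K"
      using coset_join1[OF _ _ K.subgroup_axioms] exp_of_derived_in_carrier[OF subset_refl] g by blast
  qed
  show ?thesis
  proof (rule residually_solvableI)
    fix g assume g: "g \<in> carrier G" "g \<noteq> \<one>"
    show "\<exists>n. g \<notin> (derived G ^^ n) (carrier G)"
    proof (cases "g \<in> K")
      case False
      then show ?thesis using dK by blast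
    next
      case True
      then obtain w where w: "w \<in> carrier (free_group S)" "g = \<beta> w" using img by blast
      then have "w \<noteq> \<one>\<^bsub>free_group S\<^esub>" using g by auto
      from free_group_notin_derived[OF w(1) this] obtain m
        where m: "w \<notin> (derived (free_group S) ^^ m) (carrier (free_group S))" by blast
      have "(derived G ^^ (m + n)) (carrier G) \<subseteq> (derived G ^^ m) K"
        using mono_exp_of_derived[OF dK] by (simp add: funpow_add)
      also have "\<dots> = \<beta> ` (derived (free_group S) ^^ m) (carrier (free_group S))"
        using \<beta>.exp_of_derived_img[OF subset_refl, of m] by (simp add: img)
      finally have "(derived G ^^ (m + n)) (carrier G) \<subseteq> \<beta> ` (derived (free_group S) ^^ m) (carrier (free_group S))" .
      moreover have "g \<notin> \<beta> ` (derived (free_group S) ^^ m) (carrier (free_group S))"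
        using m w inj F.exp_of_derived_in_carrier[OF subset_refl, of m] by (auto dest: inj_onD)
      ultimately show ?thesis by blast
    qed
  qed
qed

section \<open>Actions of a generalized free product\<close>

lemma BijGroup_mult_apply:
  assumes "u \<in> carrier (BijGroup E)" "v \<in> carrier (BijGroup E)" "s \<in> E"
  shows "(u \<otimes>\<^bsub>BijGroup E\<^esub> v) s = u (v s)"
  using assms by (simp add: BijGroup_def compose_def)

lemma BijGroup_one_apply: "s \<in> E \<Longrightarrow> \<one>\<^bsub>BijGroup E\<^esub> s = s"
  by (simp add: BijGroup_def)

lemma BijGroup_closed: "u \<in> carrier (BijGroup E) \<Longrightarrow> s \<in> E \<Longrightarrow> u s \<in> E"
  by (auto simp: BijGroup_def dest: Bij_imp_funcset)

lemma BijGroup_eqI: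
  assumes "u \<in> carrier (BijGroup E)" "v \<in> carrier (BijGroup E)" "\<And>s. s \<in> E \<Longrightarrow> u s = v s"
  shows "u = v"
  using assms by (auto simp: BijGroup_def intro: extensionalityI[of _ E] dest: Bij_imp_extensional)

text \<open>Bijectivity of \<open>act i a\<close> comes from \<open>act i\<close> at the inverse
  element, so what has to be checked is the laws of an action for each factor separately and
  agreement on \<open>C\<close>.\<close>

lemma generalized_free_product_action:
  fixes I :: "'i set" and A :: "'i \<Rightarrow> ('a, 'm) monoid_scheme"
    and C :: "('c, 'n) monoid_scheme" and \<phi> :: "'i \<Rightarrow> 'c \<Rightarrow> 'a"
  assumes A: "\<And>i. i \<in> I \<Longrightarrow> group (A i)" and \<phi>: "\<And>i. i \<in> I \<Longrightarrow> \<phi> i \<in> hom C (A i)"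
    and closed: "\<And>i a s. i \<in> I \<Longrightarrow> a \<in> carrier (A i) \<Longrightarrow> s \<in> E \<Longrightarrow> act i a s \<in> E"
    and mult: "\<And>i a b s. i \<in> I \<Longrightarrow> a \<in> carrier (A i) \<Longrightarrow> b \<in> carrier (A i) \<Longrightarrow> s \<in> E \<Longrightarrow>
      act i (a \<otimes>\<^bsub>A i\<^esub> b) s = act i a (act i b s)"
    and one: "\<And>i s. i \<in> I \<Longrightarrow> s \<in> E \<Longrightarrow> act i \<one>\<^bsub>A i\<^esub> s = s"
    and agree: "\<And>i j c s. i \<in> I \<Longrightarrow> j \<in> I \<Longrightarrow> c \<in> carrier C \<Longrightarrow> s \<in> E \<Longrightarrow>
      act i (\<phi> i c) s = act j (\<phi> j c) s"
  obtains h where "h \<in> hom (generalized_free_product I A C \<phi>) (BijGroup E)"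
    "\<And>i a s. i \<in> I \<Longrightarrow> a \<in> carrier (A i) \<Longrightarrow> s \<in> E \<Longrightarrow> h (amalgam_incl I A C \<phi> i a) s = act i a s"
proof -
  define f where "f i a = restrict (act i a) E" for i a
  have Bij: "f i a \<in> Bij E" if i: "i \<in> I" and a: "a \<in> carrier (A i)" for i a
  proof -
    interpret Ai: group "A i" using A[OF i] .
    have "act i (inv\<^bsub>A i\<^esub> a) (act i a s) = s" "act i a (act i (inv\<^bsub>A i\<^esub> a) s) = s" if "s \<in> E" for s
      using that i a mult[of i "inv\<^bsub>A i\<^esub> a" a s] mult[of i a "inv\<^bsub>A i\<^esub> a" s] one by simp_all
    then have "bij_betw (act i a) E E"
      using closed[OF i] a by (intro bij_betwI[where g = "act i (inv\<^bsub>A i\<^esub> a)"]) auto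
    then show ?thesis by (simp add: Bij_def f_def bij_betw_restrict_eq)
  qed
  have hom: "f i \<in> hom (A i) (BijGroup E)" if i: "i \<in> I" for i
  proof (rule homI)
    interpret Ai: group "A i" using A[OF i] .
    show "f i a \<in> carrier (BijGroup E)" if "a \<in> carrier (A i)" for a
      using Bij i that by (simp add: BijGroup_def)
    show "f i (a \<otimes>\<^bsub>A i\<^esub> b) = f i a \<otimes>\<^bsub>BijGroup E\<^esub> f i b"
      if a: "a \<in> carrier (A i)" and b: "b \<in> carrier (A i)" for a b
    proof -
      have "f i (a \<otimes>\<^bsub>A i\<^esub> b) = compose E (f i a) (f i b)"
        using mult[OF i a b] closed[OF i b] by (auto simp: f_def compose_def restrict_def)
      then show ?thesis using Bij[OF i a] Bij[OF i b] by (simp add: BijGroup_def)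
    qed
  qed
  have agr: "f i (\<phi> i c) = f j (\<phi> j c)" if "i \<in> I" "j \<in> I" "c \<in> carrier C" for i j c
    using agree[OF that] by (auto simp: f_def restrict_def)
  obtain h where h: "h \<in> hom (generalized_free_product I A C \<phi>) (BijGroup E)"
    "\<And>i a. i \<in> I \<Longrightarrow> a \<in> carrier (A i) \<Longrightarrow> h (amalgam_incl I A C \<phi> i a) = f i a"
    using generalized_free_product_universal[of I A \<phi> C "BijGroup E" f, OF A \<phi> group_BijGroup hom agr]
    by metis
  show thesis
    by (rule that[OF h(1)]) (simp add: h(2) f_def)
qed

section \<open>Amalgamating a central subgroup\<close>

text \<open>\<open>r i\<close> picks a representative of each coset of \<open>\<phi> i ` carrier C\<close>, and \<open>\<kappa> i\<close> is the
  corresponding \<open>C\<close>-component.\<close>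

locale central_amalgam =
  fixes I :: "'i set" and A :: "'i \<Rightarrow> ('a, 'm) monoid_scheme"
    and C :: "('c, 'n) monoid_scheme" and \<phi> :: "'i \<Rightarrow> 'c \<Rightarrow> 'a"
    and r :: "'i \<Rightarrow> 'a \<Rightarrow> 'a" and \<kappa> :: "'i \<Rightarrow> 'a \<Rightarrow> 'c"
  assumes group_A: "i \<in> I \<Longrightarrow> group (A i)" and group_C: "group C"
    and \<phi>_mon: "i \<in> I \<Longrightarrow> \<phi> i \<in> mon C (A i)"
    and central: "i \<in> I \<Longrightarrow> c \<in> carrier C \<Longrightarrow> a \<in> carrier (A i) \<Longrightarrow>
      \<phi> i c \<otimes>\<^bsub>A i\<^esub> a = a \<otimes>\<^bsub>A i\<^esub> \<phi> i c"
    and r_closed: "i \<in> I \<Longrightarrow> a \<in> carrier (A i) \<Longrightarrow> r i a \<in> carrier (A i)"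
    and \<kappa>_closed: "i \<in> I \<Longrightarrow> a \<in> carrier (A i) \<Longrightarrow> \<kappa> i a \<in> carrier C"
    and r_\<kappa>: "i \<in> I \<Longrightarrow> a \<in> carrier (A i) \<Longrightarrow> r i a \<otimes>\<^bsub>A i\<^esub> \<phi> i (\<kappa> i a) = a"
    and r_mult: "i \<in> I \<Longrightarrow> a \<in> carrier (A i) \<Longrightarrow> c \<in> carrier C \<Longrightarrow> r i (a \<otimes>\<^bsub>A i\<^esub> \<phi> i c) = r i a"
    and r_one: "i \<in> I \<Longrightarrow> r i \<one>\<^bsub>A i\<^esub> = \<one>\<^bsub>A i\<^esub>"
begin

sublocale C: group C by (rule group_C)

abbreviation G where "G \<equiv> generalized_free_product I A C \<phi>"
abbreviation \<iota> where "\<iota> \<equiv> amalgam_incl I A C \<phi>"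

lemma \<phi>_hom: "i \<in> I \<Longrightarrow> \<phi> i \<in> hom C (A i)"
  using \<phi>_mon by (auto simp: mon_def)

lemma \<phi>_closed: "i \<in> I \<Longrightarrow> c \<in> carrier C \<Longrightarrow> \<phi> i c \<in> carrier (A i)"
  using \<phi>_hom by (rule hom_in_carrier)

lemma \<phi>_inj: "i \<in> I \<Longrightarrow> c \<in> carrier C \<Longrightarrow> d \<in> carrier C \<Longrightarrow> \<phi> i c = \<phi> i d \<Longrightarrow> c = d"
  using \<phi>_mon by (auto simp: mon_def dest: inj_onD)

text \<open>Both elements have the same representative, which cancels; the remaining parts are
  compared in \<open>C\<close> through injectivity of \<open>\<phi> i\<close>.\<close>

lemma \<kappa>_mult:
  assumes i: "i \<in> I" and a: "a \<in> carrier (A i)" and c: "c \<in> carrier C"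
  shows "\<kappa> i (a \<otimes>\<^bsub>A i\<^esub> \<phi> i c) = \<kappa> i a \<otimes>\<^bsub>C\<^esub> c"
proof -
  interpret Ai: group "A i" using group_A[OF i] .
  let ?b = "a \<otimes>\<^bsub>A i\<^esub> \<phi> i c"
  have b: "?b \<in> carrier (A i)" using a \<phi>_closed[OF i c] by simp
  have "r i a \<otimes>\<^bsub>A i\<^esub> \<phi> i (\<kappa> i ?b) = (r i a \<otimes>\<^bsub>A i\<^esub> \<phi> i (\<kappa> i a)) \<otimes>\<^bsub>A i\<^esub> \<phi> i c"
    using r_\<kappa>[OF i b] r_mult[OF i a c] r_\<kappa>[OF i a] by simp
  also have "\<dots> = r i a \<otimes>\<^bsub>A i\<^esub> \<phi> i (\<kappa> i a \<otimes>\<^bsub>C\<^esub> c)"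
    using hom_mult[OF \<phi>_hom[OF i] \<kappa>_closed[OF i a] c] r_closed[OF i a] \<phi>_closed[OF i] \<kappa>_closed[OF i a] c
    by (simp add: Ai.m_assoc)
  finally have "\<phi> i (\<kappa> i ?b) = \<phi> i (\<kappa> i a \<otimes>\<^bsub>C\<^esub> c)"
    using r_closed[OF i a] \<phi>_closed[OF i] \<kappa>_closed[OF i] a b c by simp
  then show ?thesis
    using \<phi>_inj[OF i] \<kappa>_closed[OF i] a b c by simp
qed

lemma r_r:
  assumes i: "i \<in> I" and a: "a \<in> carrier (A i)"
  shows "r i (r i a) = r i a"
  using r_mult[OF i r_closed[OF i a] \<kappa>_closed[OF i a]] r_\<kappa>[OF i a] by simp

lemma \<kappa>_rep:
  assumes i: "i \<in> I" and a: "a \<in> carrier (A i)" and "r i a = a"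
  shows "\<kappa> i a = \<one>\<^bsub>C\<^esub>"
proof -
  have "\<kappa> i a = \<kappa> i (r i a) \<otimes>\<^bsub>C\<^esub> \<kappa> i a"
    using \<kappa>_mult[OF i r_closed[OF i a] \<kappa>_closed[OF i a]] r_\<kappa>[OF i a] by simp
  then show ?thesis using \<kappa>_closed[OF i a] assms(3) by simp
qed

text \<open>\<open>C\<close> is abelian because it embeds in the centre of a factor. An empty family
  provides no such embedding, hence the index in the statement.\<close>

lemma C_commute: "i \<in> I \<Longrightarrow> c \<in> carrier C \<Longrightarrow> d \<in> carrier C \<Longrightarrow> c \<otimes>\<^bsub>C\<^esub> d = d \<otimes>\<^bsub>C\<^esub> c"
  using central[of i c "\<phi> i d"] \<phi>_closed hom_mult[OF \<phi>_hom, of i c d] hom_mult[OF \<phi>_hom, of i d c]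
  by (intro \<phi>_inj[of i]) simp_all

sublocale G: group G
  using group_A \<phi>_hom by (rule group_generalized_free_product)

lemma \<iota>_hom: "i \<in> I \<Longrightarrow> \<iota> i \<in> hom (A i) G"
  using group_A \<phi>_hom by (rule amalgam_incl_hom)

lemma \<iota>_closed: "i \<in> I \<Longrightarrow> a \<in> carrier (A i) \<Longrightarrow> \<iota> i a \<in> carrier G"
  using \<iota>_hom by (rule hom_in_carrier)

lemma \<iota>_mult: "i \<in> I \<Longrightarrow> a \<in> carrier (A i) \<Longrightarrow> b \<in> carrier (A i) \<Longrightarrow>
    \<iota> i (a \<otimes>\<^bsub>A i\<^esub> b) = \<iota> i a \<otimes>\<^bsub>G\<^esub> \<iota> i b"
  using \<iota>_hom by (rule hom_mult)

lemma \<iota>_one: "i \<in> I \<Longrightarrow> \<iota> i \<one>\<^bsub>A i\<^esub> = \<one>\<^bsub>G\<^esub>"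
  using hom_one[OF \<iota>_hom group_A G.is_group] .

lemma \<iota>_inv: "i \<in> I \<Longrightarrow> a \<in> carrier (A i) \<Longrightarrow> \<iota> i (inv\<^bsub>A i\<^esub> a) = inv\<^bsub>G\<^esub> \<iota> i a"
  using group_hom.hom_inv[of "A i" G "\<iota> i" a] \<iota>_hom[of i] group_A[of i]
  by (simp add: group_hom_def group_hom_axioms_def)

text \<open>Inverses of the generators are again images of factor elements, so left multiplication
  by factor elements alone reaches all of \<open>G\<close>.\<close>

lemma G_induct [consumes 1, case_names one mult]:
  assumes "g \<in> carrier G" and one: "P \<one>\<^bsub>G\<^esub>"
    and mult: "\<And>i a g. i \<in> I \<Longrightarrow> a \<in> carrier (A i) \<Longrightarrow> g \<in> carrier G \<Longrightarrow> P g \<Longrightarrow> P (\<iota> i a \<otimes>\<^bsub>G\<^esub> g)"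
  shows "P g"
proof -
  let ?B = "\<Union>i\<in>I. \<iota> i ` carrier (A i)"
  have B: "carrier G = generate G ?B"
    using group_A \<phi>_hom by (rule generalized_free_product_generated)
  have "g \<in> generate G ?B" using assms(1) B by simp
  \<comment> \<open>Carrying an arbitrary right factor \<open>k\<close> along lets the case of a
    product follow by associativity.\<close>
  then have "\<forall>k \<in> carrier G. P k \<longrightarrow> P (g \<otimes>\<^bsub>G\<^esub> k)"
  proof (induction rule: generate.induct)
    case (incl h)
    then show ?case using mult by blast
  next
    case (inv h)
    then obtain i a where i: "i \<in> I" "a \<in> carrier (A i)" "h = \<iota> i a" by blast
    interpret Ai: group "A i" using group_A[OF i(1)] .
    show ?case using mult[OF i(1) Ai.inv_closed[OF i(2)]] i by (simp add: \<iota>_inv)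
  next
    case (eng h1 h2)
    have "h1 \<in> carrier G" "h2 \<in> carrier G" using eng B by auto
    with eng show ?case by (simp add: G.m_assoc)
  qed simp
  from this[rule_format, of "\<one>\<^bsub>G\<^esub>"] one assms(1) show ?thesis by simp
qed

text \<open>This is the common image of \<open>C\<close> in \<open>G\<close>; amalgamation makes the
  chosen index immaterial. For an empty family \<open>G\<close> is trivial while \<open>C\<close>
  need not be, so all of \<open>C\<close> is sent to the identity.\<close>

definition \<zeta> :: "'c \<Rightarrow> ('i \<times> 'a) list set set" where
  "\<zeta> c = (if I = {} then \<one>\<^bsub>G\<^esub> else \<iota> (SOME i. i \<in> I) (\<phi> (SOME i. i \<in> I) c))"

lemma \<zeta>_eq:
  assumes "i \<in> I" "c \<in> carrier C"
  shows "\<zeta> c = \<iota> i (\<phi> i c)"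
proof -
  have "(SOME i. i \<in> I) \<in> I" using assms(1) by (rule someI)
  then have "\<iota> (SOME i. i \<in> I) (\<phi> (SOME i. i \<in> I) c) = \<iota> i (\<phi> i c)"
    using assms by (intro amalgam_incl_agree group_A \<phi>_hom)
  moreover have "I \<noteq> {}" using assms(1) by blast
  ultimately show ?thesis by (simp only: \<zeta>_def if_False)
qed

lemma \<zeta>_empty: "I = {} \<Longrightarrow> \<zeta> c = \<one>\<^bsub>G\<^esub>"
  unfolding \<zeta>_def by simp

lemma \<zeta>_closed:
  assumes "c \<in> carrier C"
  shows "\<zeta> c \<in> carrier G"
proof (cases "I = {}")
  case True
  show ?thesis unfolding \<zeta>_empty[OF True] by (rule G.one_closed)
next
  case False
  then obtain i where "i \<in> I" by blast
  then show ?thesis using assms \<iota>_closed \<phi>_closed by (simp add: \<zeta>_eq)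
qed

lemma \<zeta>_one: "\<zeta> \<one>\<^bsub>C\<^esub> = \<one>\<^bsub>G\<^esub>"
proof (cases "I = {}")
  case False
  then obtain i where "i \<in> I" by blast
  then show ?thesis
    using \<zeta>_eq hom_one[OF \<phi>_hom group_C group_A] \<iota>_one by simp
qed (rule \<zeta>_empty)

lemma \<zeta>_mult:
  assumes i: "i \<in> I" and c: "c \<in> carrier C" and d: "d \<in> carrier C"
  shows "\<zeta> (c \<otimes>\<^bsub>C\<^esub> d) = \<zeta> c \<otimes>\<^bsub>G\<^esub> \<zeta> d"
  using \<zeta>_eq[OF i] c d hom_mult[OF \<phi>_hom[OF i] c d] \<iota>_mult[OF i] \<phi>_closed[OF i] by simp

text \<open>Centrality in each factor suffices because the factors generate \<open>G\<close> and
  share the image of \<open>C\<close>.\<close>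

lemma \<zeta>_central:
  assumes "g \<in> carrier G" "c \<in> carrier C"
  shows "\<zeta> c \<otimes>\<^bsub>G\<^esub> g = g \<otimes>\<^bsub>G\<^esub> \<zeta> c"
  using assms(1)
proof (induction rule: G_induct)
  case one
  show ?case using \<zeta>_closed[OF assms(2)] by simp
next
  case (mult i a g)
  have "\<zeta> c \<otimes>\<^bsub>G\<^esub> \<iota> i a = \<iota> i a \<otimes>\<^bsub>G\<^esub> \<zeta> c"
    using central[OF mult(1) assms(2) mult(2)] \<phi>_closed[OF mult(1) assms(2)] mult(2)
    by (simp add: \<zeta>_eq[OF mult(1) assms(2)] flip: \<iota>_mult[OF mult(1)])
  then have "\<zeta> c \<otimes>\<^bsub>G\<^esub> (\<iota> i a \<otimes>\<^bsub>G\<^esub> g) = \<iota> i a \<otimes>\<^bsub>G\<^esub> (\<zeta> c \<otimes>\<^bsub>G\<^esub> g)"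
    using mult(3) \<zeta>_closed[OF assms(2)] \<iota>_closed[OF mult(1,2)] by (simp flip: G.m_assoc)
  then show ?case
    using mult(3,4) \<zeta>_closed[OF assms(2)] \<iota>_closed[OF mult(1,2)] by (simp add: G.m_assoc)
qed

definition supp :: "('i \<Rightarrow> 'a) \<Rightarrow> 'i set" where
  "supp q = {i. q i \<noteq> \<one>\<^bsub>A i\<^esub>}"

definition neutral :: "'i \<Rightarrow> 'a" where
  "neutral i = \<one>\<^bsub>A i\<^esub>"

text \<open>\<open>supp q \<subseteq> I\<close> fixes the values outside \<open>I\<close>, so that
  each vector of representatives is a single function and \<open>neutral\<close> is the only one
  with empty support.\<close>

definition coords :: "('i \<Rightarrow> 'a) set" where
  "coords = {q. finite (supp q) \<and> supp q \<subseteq> I \<and> (\<forall>i\<in>I. q i \<in> carrier (A i) \<and> r i (q i) = q i)}"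

lemma supp_upd: "supp (q(i := a)) \<subseteq> insert i (supp q)"
  by (auto simp: supp_def)

lemma coords_upd:
  assumes "q \<in> coords" "i \<in> I" "a \<in> carrier (A i)" "r i a = a"
  shows "q(i := a) \<in> coords"
  using assms finite_subset[OF supp_upd[of q i a]] supp_upd[of q i a] by (auto simp: coords_def)

lemma coordsD: "q \<in> coords \<Longrightarrow> i \<in> I \<Longrightarrow> q i \<in> carrier (A i)" "q \<in> coords \<Longrightarrow> i \<in> I \<Longrightarrow> r i (q i) = q i"
  by (auto simp: coords_def)

lemma neutral_coords: "neutral \<in> coords"
  using r_one group_A by (auto simp: coords_def neutral_def supp_def group.is_monoid)

abbreviation clear :: "('i \<Rightarrow> 'a) \<Rightarrow> 'i \<Rightarrow> 'i \<Rightarrow> 'a" where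
  "clear q i \<equiv> q(i := \<one>\<^bsub>A i\<^esub>)"

lemma clear_coords: "q \<in> coords \<Longrightarrow> i \<in> I \<Longrightarrow> clear q i \<in> coords"
  using coords_upd[of q i "\<one>\<^bsub>A i\<^esub>"] r_one group_A by (simp add: group.is_monoid)

lemma supp_clear: "supp (clear q i) = supp q - {i}"
  by (auto simp: supp_def)

definition states :: "('f, 'k) monoid_scheme \<Rightarrow> (('i \<Rightarrow> 'a) \<times> 'c \<times> 'f) set" where
  "states F = coords \<times> carrier C \<times> carrier F"

text \<open>The telescoping form of the last component makes this an action for every \<open>\<xi>\<close>; with
  constant \<open>\<xi>\<close> it is the action on the central product.\<close>

definition move ::
    "('f, 'k) monoid_scheme \<Rightarrow> (('i \<Rightarrow> 'a) \<Rightarrow> 'i \<Rightarrow> 'f) \<Rightarrow> 'i \<Rightarrow> 'a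
       \<Rightarrow> ('i \<Rightarrow> 'a) \<times> 'c \<times> 'f \<Rightarrow> ('i \<Rightarrow> 'a) \<times> 'c \<times> 'f" where
  "move F \<xi> i a = (\<lambda>(q, c, f).
     (q(i := r i (a \<otimes>\<^bsub>A i\<^esub> q i)), \<kappa> i (a \<otimes>\<^bsub>A i\<^esub> q i) \<otimes>\<^bsub>C\<^esub> c,
      \<xi> (q(i := r i (a \<otimes>\<^bsub>A i\<^esub> q i))) i \<otimes>\<^bsub>F\<^esub> (inv\<^bsub>F\<^esub> \<xi> q i \<otimes>\<^bsub>F\<^esub> f)))"

lemma action_exists:
  assumes F: "group F" and \<xi>: "\<And>q i. q \<in> coords \<Longrightarrow> i \<in> I \<Longrightarrow> \<xi> q i \<in> carrier F"
  obtains h where "h \<in> hom G (BijGroup (states F))"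
    "\<And>i a s. i \<in> I \<Longrightarrow> a \<in> carrier (A i) \<Longrightarrow> s \<in> states F \<Longrightarrow> h (\<iota> i a) s = move F \<xi> i a s"
proof -
  interpret F: group F by fact
  have closed: "move F \<xi> i a s \<in> states F"
    if i: "i \<in> I" and a: "a \<in> carrier (A i)" and s: "s \<in> states F" for i a s
  proof -
    interpret Ai: group "A i" using group_A[OF i] .
    obtain q c f where s: "s = (q, c, f)" "q \<in> coords" "c \<in> carrier C" "f \<in> carrier F"
      using s by (auto simp: states_def)
    have "a \<otimes>\<^bsub>A i\<^esub> q i \<in> carrier (A i)" using coordsD[OF s(2) i] a by simp
    then have "q(i := r i (a \<otimes>\<^bsub>A i\<^esub> q i)) \<in> coords" "\<kappa> i (a \<otimes>\<^bsub>A i\<^esub> q i) \<in> carrier C"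
      using s(2) i r_closed r_r \<kappa>_closed by (auto intro: coords_upd)
    then show ?thesis using s i \<xi> by (simp add: move_def states_def)
  qed
  have mult: "move F \<xi> i (a \<otimes>\<^bsub>A i\<^esub> b) s = move F \<xi> i a (move F \<xi> i b s)"
    if i: "i \<in> I" and a: "a \<in> carrier (A i)" and b: "b \<in> carrier (A i)" and s: "s \<in> states F" for i a b s
  proof -
    interpret Ai: group "A i" using group_A[OF i] .
    obtain q c f where s: "s = (q, c, f)" "q \<in> coords" "c \<in> carrier C" "f \<in> carrier F"
      using s by (auto simp: states_def)
    have q: "q i \<in> carrier (A i)" using coordsD[OF s(2) i] by simp
    have bq: "b \<otimes>\<^bsub>A i\<^esub> q i \<in> carrier (A i)" using q b by simp
    \<comment> \<open>Acting by \<open>b\<close> first leaves the representative \<open>p\<close>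
      and sends \<open>k\<close> to the \<open>C\<close>-component. Since \<open>\<phi> i k\<close>
      stands on the right, it does not change the representative of the product of \<open>a\<close>
      and \<open>p\<close> and only multiplies the \<open>C\<close>-component.\<close>
    define p where "p = r i (b \<otimes>\<^bsub>A i\<^esub> q i)"
    define k where "k = \<kappa> i (b \<otimes>\<^bsub>A i\<^esub> q i)"
    have p: "p \<in> carrier (A i)" "r i p = p" and k: "k \<in> carrier C"
      using bq i r_closed r_r \<kappa>_closed by (auto simp: p_def k_def)
    have "(a \<otimes>\<^bsub>A i\<^esub> b) \<otimes>\<^bsub>A i\<^esub> q i = (a \<otimes>\<^bsub>A i\<^esub> p) \<otimes>\<^bsub>A i\<^esub> \<phi> i k"
      using r_\<kappa>[OF i bq] a b q p(1) \<phi>_closed[OF i k] by (simp add: Ai.m_assoc p_def k_def)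
    then have eq: "r i ((a \<otimes>\<^bsub>A i\<^esub> b) \<otimes>\<^bsub>A i\<^esub> q i) = r i (a \<otimes>\<^bsub>A i\<^esub> p)"
      "\<kappa> i ((a \<otimes>\<^bsub>A i\<^esub> b) \<otimes>\<^bsub>A i\<^esub> q i) = \<kappa> i (a \<otimes>\<^bsub>A i\<^esub> p) \<otimes>\<^bsub>C\<^esub> k"
      using r_mult[OF i _ k] \<kappa>_mult[OF i _ k] a p(1) by simp_all
    have ap: "a \<otimes>\<^bsub>A i\<^esub> p \<in> carrier (A i)" using a p by simp
    have \<xi>s: "\<xi> (q(i := p)) i \<in> carrier F" "\<xi> q i \<in> carrier F" "\<xi> (q(i := r i (a \<otimes>\<^bsub>A i\<^esub> p))) i \<in> carrier F"
      using s(2) i p ap r_closed r_r by (auto intro!: \<xi> coords_upd)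
    show ?thesis
      using s \<xi>s k \<kappa>_closed[OF i ap]
      by (simp add: move_def eq C.m_assoc F.m_assoc F.inv_solve_left flip: p_def k_def)
  qed
  have one: "move F \<xi> i \<one>\<^bsub>A i\<^esub> s = s" if i: "i \<in> I" and s: "s \<in> states F" for i s
  proof -
    interpret Ai: group "A i" using group_A[OF i] .
    obtain q c f where s: "s = (q, c, f)" "q \<in> coords" "c \<in> carrier C" "f \<in> carrier F"
      using s by (auto simp: states_def)
    then show ?thesis
      using coordsD[OF s(2) i] \<kappa>_rep[OF i] \<xi>[OF s(2) i] by (simp add: move_def flip: F.m_assoc)
  qed
  have agree: "move F \<xi> i (\<phi> i d) s = move F \<xi> j (\<phi> j d) s"
    if ij: "i \<in> I" "j \<in> I" and d: "d \<in> carrier C" and s: "s \<in> states F" for i j d s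
  proof -
    obtain q c f where s: "s = (q, c, f)" "q \<in> coords" "c \<in> carrier C" "f \<in> carrier F"
      using s by (auto simp: states_def)
    \<comment> \<open>Centrality moves \<open>\<phi> i d\<close> to the right of \<open>q i\<close>,
      so only the \<open>C\<close>-component changes and the \<open>\<xi>\<close> factors cancel.
      The result does not mention \<open>i\<close>, which gives agreement.\<close>
    have "move F \<xi> i (\<phi> i d) s = (q, d \<otimes>\<^bsub>C\<^esub> c, f)" if i: "i \<in> I" for i
    proof -
      have "r i (\<phi> i d \<otimes>\<^bsub>A i\<^esub> q i) = q i" "\<kappa> i (\<phi> i d \<otimes>\<^bsub>A i\<^esub> q i) = d"
        using coordsD[OF s(2) i] central[OF i d] r_mult[OF i _ d] \<kappa>_mult[OF i _ d] \<kappa>_rep[OF i] d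
        by simp_all
      then show ?thesis using s \<xi>[OF s(2) i] by (simp add: move_def flip: F.m_assoc)
    qed
    with ij show ?thesis by metis
  qed
  show thesis
    by (rule generalized_free_product_action[of I A \<phi> C "states F" "move F \<xi>",
          OF group_A \<phi>_hom closed mult one agree]) (assumption | rule that)+
qed

end

section \<open>The kernel of the map onto the central product\<close>

context central_amalgam
begin

definition lead :: "('i \<Rightarrow> 'a) \<Rightarrow> 'i" where
  "lead q = (SOME i. i \<in> supp q)"

text \<open>The number counts the nontrivial coordinates still to be removed and makes the recursion
  structural. Since \<open>lead\<close> depends on the current vector alone, the path to
  \<open>q\<close> extends the path to its parent.\<close>

primrec tree_path :: "nat \<Rightarrow> ('i \<Rightarrow> 'a) \<Rightarrow> ('i \<times> 'a) list set set" where
  "tree_path 0 q = \<one>\<^bsub>G\<^esub>"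
| "tree_path (Suc n) q = \<iota> (lead q) (q (lead q)) \<otimes>\<^bsub>G\<^esub> tree_path n (clear q (lead q))"

text \<open>The edges from \<open>clear q (lead q)\<close> to \<open>q\<close> form a spanning tree rooted at \<open>neutral\<close>.\<close>

definition \<tau> :: "('i \<Rightarrow> 'a) \<Rightarrow> ('i \<times> 'a) list set set" where
  "\<tau> q = tree_path (card (supp q)) q"

text \<open>Read from right to left as a loop: along the tree to \<open>clear q i\<close>, across
  the edge that sets coordinate \<open>i\<close> to \<open>q i\<close>, and back along the tree from
  \<open>q\<close>.\<close>

definition schreier :: "('i \<Rightarrow> 'a) \<Rightarrow> 'i \<Rightarrow> ('i \<times> 'a) list set set" where
  "schreier q i = inv\<^bsub>G\<^esub> \<tau> q \<otimes>\<^bsub>G\<^esub> (\<iota> i (q i) \<otimes>\<^bsub>G\<^esub> \<tau> (clear q i))"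

lemma supp_neutral: "supp q = {} \<longleftrightarrow> q = neutral"
  by (auto simp: supp_def neutral_def)

lemma \<tau>_neutral: "\<tau> neutral = \<one>\<^bsub>G\<^esub>"
  using supp_neutral[of neutral] by (simp add: \<tau>_def)

lemma lead_in:
  assumes "q \<in> coords" "q \<noteq> neutral"
  shows "lead q \<in> supp q" "lead q \<in> I"
proof -
  show "lead q \<in> supp q"
    unfolding lead_def using assms(2) supp_neutral[of q] by (meson ex_in_conv someI_ex)
  then show "lead q \<in> I" using assms(1) by (auto simp: coords_def)
qed

lemma \<tau>_lead:
  assumes "q \<in> coords" "q \<noteq> neutral"
  shows "\<tau> q = \<iota> (lead q) (q (lead q)) \<otimes>\<^bsub>G\<^esub> \<tau> (clear q (lead q))"
proof -
  have "finite (supp q)" using assms(1) by (simp add: coords_def)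
  then have "card (supp q) = Suc (card (supp (clear q (lead q))))"
    using lead_in(1)[OF assms] by (simp only: supp_clear card_Suc_Diff1)
  then show ?thesis by (simp add: \<tau>_def)
qed

lemma card_supp_clear:
  assumes "q \<in> coords" "i \<in> supp q"
  shows "card (supp (clear q i)) < card (supp q)"
  unfolding supp_clear using assms by (intro card_Diff1_less) (simp_all add: coords_def)

text \<open>Induction along the spanning tree away from its root; clearing the lead coordinate
  shrinks the finite support.\<close>

lemma coords_induct [consumes 1, case_names neutral step]:
  assumes "q \<in> coords" and "P neutral"
    and "\<And>q. q \<in> coords \<Longrightarrow> q \<noteq> neutral \<Longrightarrow> P (clear q (lead q)) \<Longrightarrow> P q"
  shows "P q"
  using assms(1)
proof (induction "card (supp q)" arbitrary: q rule: less_induct)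
  case less
  show ?case
  proof (cases "q = neutral")
    case False
    have "P (clear q (lead q))"
      using lead_in[OF less.prems False]
      by (intro less.hyps card_supp_clear clear_coords less.prems)
    then show ?thesis using assms(3) less.prems False by blast
  qed (simp add: assms(2))
qed

lemma \<tau>_closed: "q \<in> coords \<Longrightarrow> \<tau> q \<in> carrier G"
proof (induction rule: coords_induct)
  case neutral
  show ?case by (simp add: \<tau>_neutral)
next
  case (step q)
  show ?case
    unfolding \<tau>_lead[OF step(1,2)]
    by (intro G.m_closed \<iota>_closed coordsD(1)[OF step(1)] lead_in(2)[OF step(1,2)] step.IH)
qed

lemma schreier_closed: "q \<in> coords \<Longrightarrow> i \<in> I \<Longrightarrow> schreier q i \<in> carrier G"
  unfolding schreier_def using \<tau>_closed clear_coords \<iota>_closed coordsD(1) by simp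

lemma \<tau>_schreier:
  assumes "q \<in> coords" "i \<in> I"
  shows "\<tau> q \<otimes>\<^bsub>G\<^esub> schreier q i = \<iota> i (q i) \<otimes>\<^bsub>G\<^esub> \<tau> (clear q i)"
proof -
  have "\<iota> i (q i) \<otimes>\<^bsub>G\<^esub> \<tau> (clear q i) \<in> carrier G"
    using assms \<tau>_closed clear_coords \<iota>_closed coordsD(1) by simp
  then show ?thesis
    unfolding schreier_def using \<tau>_closed[OF assms(1)] by (simp add: G.inv_solve_left' flip: G.m_assoc)
qed

lemma schreier_clear:
  assumes "q \<in> coords" "i \<in> I"
  shows "schreier (clear q i) i = \<one>\<^bsub>G\<^esub>"
  unfolding schreier_def using \<tau>_closed[OF clear_coords[OF assms]] assms(2) by (simp add: \<iota>_one)

text \<open>The edge from \<open>clear q (lead q)\<close> to \<open>q\<close> belongs to the tree,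
  so its loop backtracks.\<close>

lemma schreier_lead:
  assumes "q \<in> coords" "q \<noteq> neutral"
  shows "schreier q (lead q) = \<one>\<^bsub>G\<^esub>"
  unfolding schreier_def using \<tau>_closed[OF assms(1)] by (simp flip: \<tau>_lead[OF assms])

text \<open>Taking group elements rather than pairs \<open>(q, i)\<close> as basis makes it unnecessary to show
  that distinct pairs give distinct generators.\<close>

definition basis :: "('i \<times> 'a) list set set set" where
  "basis = {schreier q i | q i. q \<in> coords \<and> i \<in> I} - {\<one>\<^bsub>G\<^esub>}"

abbreviation F where "F \<equiv> free_group basis"

sublocale F: group F
  by (rule group_free_group)

text \<open>The label of the edge from \<open>clear q i\<close> to \<open>q\<close>. Trivial
  Schreier generators are excluded from \<open>basis\<close> and must be sent to the identity; in
  particular tree edges leave the \<open>F\<close>-component unchanged.\<close>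

definition \<xi> where
  "\<xi> q i = (if schreier q i = \<one>\<^bsub>G\<^esub> then \<one>\<^bsub>F\<^esub> else free_gen basis (schreier q i))"

lemma \<xi>_closed: "q \<in> coords \<Longrightarrow> i \<in> I \<Longrightarrow> \<xi> q i \<in> carrier F"
  unfolding \<xi>_def using F.one_closed free_gen_closed[of "schreier q i" basis]
  by (cases "schreier q i = \<one>\<^bsub>G\<^esub>") (simp, auto simp: basis_def)

lemma basis_closed: "basis \<subseteq> carrier G"
  using schreier_closed by (auto simp: basis_def)

text \<open>A Schreier generator compares inserting coordinate \<open>i\<close> last with inserting
  the coordinates in tree order, and the order is irrelevant once the factors commute.\<close>

lemma schreier_trivial_if_factors_commute:
  assumes "group_hom G H h"
    and comm: "\<And>i j a b. i \<in> I \<Longrightarrow> j \<in> I \<Longrightarrow> i \<noteq> j \<Longrightarrow> a \<in> carrier (A i) \<Longrightarrow> b \<in> carrier (A j) \<Longrightarrow>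
      h (\<iota> i a) \<otimes>\<^bsub>H\<^esub> h (\<iota> j b) = h (\<iota> j b) \<otimes>\<^bsub>H\<^esub> h (\<iota> i a)"
    and q: "q \<in> coords" and i: "i \<in> I"
  shows "h (schreier q i) = \<one>\<^bsub>H\<^esub>"
proof -
  interpret h: group_hom G H h by fact
  \<comment> \<open>Any coordinate, not only the lead, may be split off first; the claim then
    follows by cancelling.\<close>
  have *: "h (\<tau> q) = h (\<iota> i (q i)) \<otimes>\<^bsub>H\<^esub> h (\<tau> (clear q i))"
    using q i
  proof (induction "card (supp q)" arbitrary: q i rule: less_induct)
    case less
    note q = less.prems(1) and i = less.prems(2)
    show ?case
    proof (cases "i \<in> supp q")
      case False
      then have "q i = \<one>\<^bsub>A i\<^esub>" by (simp add: supp_def)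
      then have "clear q i = q" by (metis fun_upd_triv)
      then show ?thesis using \<open>q i = _\<close> \<iota>_one[OF i] \<tau>_closed[OF q] by simp
    next
      case True
      then have "q \<noteq> neutral" using supp_neutral[of q] by auto
      note l = lead_in[OF q this] and \<tau>l = \<tau>_lead[OF q this]
      define l where "l = lead q"
      note l = l[folded l_def] and \<tau>l = \<tau>l[folded l_def]
      show ?thesis
      proof (cases "l = i")
        case True
        then show ?thesis
          using \<tau>l i \<iota>_closed[OF i coordsD(1)[OF q i]] \<tau>_closed[OF clear_coords[OF q i]] by simp
      next
        case False
        let ?ql = "clear q l" and ?qi = "clear q i" and ?qli = "clear (clear q l) i"
        have swap: "clear ?qi l = ?qli" using False by (simp add: fun_upd_twist)
        have c: "?ql \<in> coords" "?qi \<in> coords" "?qli \<in> coords"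
          using q i l(2) by (auto intro!: clear_coords)
        have qA: "q i \<in> carrier (A i)" "q l \<in> carrier (A l)" using q i l(2) coordsD(1) by auto
        have hc: "h (\<iota> i (q i)) \<in> carrier H" "h (\<iota> l (q l)) \<in> carrier H" "h (\<tau> ?qli) \<in> carrier H"
          using \<iota>_closed[OF i qA(1)] \<iota>_closed[OF l(2) qA(2)] \<tau>_closed[OF c(3)] by auto
        \<comment> \<open>Both smaller vectors are reduced to the same \<open>?qli\<close>:
          \<open>i\<close> is split off after \<open>l\<close>, and \<open>l\<close> after
          \<open>i\<close>. Commuting the two factors then joins the two expansions.\<close>
        have IH1: "h (\<tau> ?ql) = h (\<iota> i (q i)) \<otimes>\<^bsub>H\<^esub> h (\<tau> ?qli)"
          using less.hyps[OF card_supp_clear[OF q l(1)] c(1) i] False by simp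
        have IH2: "h (\<tau> ?qi) = h (\<iota> l (q l)) \<otimes>\<^bsub>H\<^esub> h (\<tau> ?qli)"
          using less.hyps[OF card_supp_clear[OF q True] c(2) l(2)] False by (simp add: swap)
        have "h (\<tau> q) = h (\<iota> l (q l)) \<otimes>\<^bsub>H\<^esub> h (\<tau> ?ql)"
          using \<tau>l \<iota>_closed[OF l(2) qA(2)] \<tau>_closed[OF c(1)] by simp
        also have "\<dots> = (h (\<iota> l (q l)) \<otimes>\<^bsub>H\<^esub> h (\<iota> i (q i))) \<otimes>\<^bsub>H\<^esub> h (\<tau> ?qli)"
          unfolding IH1 using hc by (simp add: h.H.m_assoc)
        also have "\<dots> = (h (\<iota> i (q i)) \<otimes>\<^bsub>H\<^esub> h (\<iota> l (q l))) \<otimes>\<^bsub>H\<^esub> h (\<tau> ?qli)"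
          using comm[OF l(2) i False qA(2,1)] by simp
        also have "\<dots> = h (\<iota> i (q i)) \<otimes>\<^bsub>H\<^esub> h (\<tau> ?qi)"
          unfolding IH2 using hc by (simp add: h.H.m_assoc)
        finally show ?thesis .
      qed
    qed
  qed
  have "h (schreier q i) = inv\<^bsub>H\<^esub> h (\<tau> q) \<otimes>\<^bsub>H\<^esub> (h (\<iota> i (q i)) \<otimes>\<^bsub>H\<^esub> h (\<tau> (clear q i)))"
    unfolding schreier_def
    using \<tau>_closed[OF q] \<tau>_closed[OF clear_coords[OF q i]] \<iota>_closed[OF i coordsD(1)[OF q i]] by simp
  also have "\<dots> = \<one>\<^bsub>H\<^esub>" using \<tau>_closed[OF q] by (simp flip: *)
  finally show ?thesis .
qed

theorem free_by_nilpotent: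
  assumes nilp: "\<And>i. i \<in> I \<Longrightarrow> lower_central_series (A i) n = {\<one>\<^bsub>A i\<^esub>}"
  obtains K \<beta> where "K \<lhd> G" "nilpotent_group (G Mod K)" "\<beta> \<in> iso F (G\<lparr>carrier := K\<rparr>)"
proof -

  \<comment> \<open>Two actions of \<open>G\<close> on the state set\<close>
  obtain \<rho> where \<rho>: "\<rho> \<in> hom G (BijGroup (states F))"
    and \<rho>_move: "\<And>i a s. i \<in> I \<Longrightarrow> a \<in> carrier (A i) \<Longrightarrow> s \<in> states F \<Longrightarrow> \<rho> (\<iota> i a) s = move F \<xi> i a s"
    by (rule action_exists[of F \<xi>, OF F.is_group]) (assumption | rule \<xi>_closed that)+
  obtain \<rho>\<^sub>1 where \<rho>\<^sub>1: "\<rho>\<^sub>1 \<in> hom G (BijGroup (states F))"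
    and \<rho>\<^sub>1_move: "\<And>i a s. i \<in> I \<Longrightarrow> a \<in> carrier (A i) \<Longrightarrow> s \<in> states F \<Longrightarrow>
      \<rho>\<^sub>1 (\<iota> i a) s = move F (\<lambda>_ _. \<one>\<^bsub>F\<^esub>) i a s"
    by (rule action_exists[of F "\<lambda>_ _. \<one>\<^bsub>F\<^esub>", OF F.is_group]) (assumption | rule F.one_closed that)+
  interpret \<rho>: group_hom G "BijGroup (states F)" \<rho>
    using \<rho> group_BijGroup by (simp add: group_hom_def group_hom_axioms_def)
  interpret \<rho>\<^sub>1: group_hom G "BijGroup (states F)" \<rho>\<^sub>1
    using \<rho>\<^sub>1 group_BijGroup by (simp add: group_hom_def group_hom_axioms_def)
  have \<rho>_mult: "\<rho> (g \<otimes>\<^bsub>G\<^esub> k) s = \<rho> g (\<rho> k s)" and \<rho>\<^sub>1_mult: "\<rho>\<^sub>1 (g \<otimes>\<^bsub>G\<^esub> k) s = \<rho>\<^sub>1 g (\<rho>\<^sub>1 k s)"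
    if "g \<in> carrier G" "k \<in> carrier G" "s \<in> states F" for g k s
    using that by (simp_all add: BijGroup_mult_apply)
  have \<rho>_one: "\<rho> \<one>\<^bsub>G\<^esub> s = s" and \<rho>\<^sub>1_one: "\<rho>\<^sub>1 \<one>\<^bsub>G\<^esub> s = s" if "s \<in> states F" for s
    using that by (simp_all add: BijGroup_one_apply)
  have \<rho>_closed: "\<rho> g s \<in> states F" and \<rho>\<^sub>1_closed: "\<rho>\<^sub>1 g s \<in> states F"
    if "g \<in> carrier G" "s \<in> states F" for g s
    using that by (simp_all add: BijGroup_closed)
  have \<rho>_inv: "\<rho> (inv\<^bsub>G\<^esub> g) t = s" if "g \<in> carrier G" "s \<in> states F" "\<rho> g s = t" for g s t
    using that \<rho>_mult[of "inv\<^bsub>G\<^esub> g" g s] \<rho>_one by simp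

  \<comment> \<open>The kernel \<open>K\<close> and nilpotency of its quotient\<close>
  define K where "K = kernel G (BijGroup (states F)) \<rho>\<^sub>1"
  have K: "K \<lhd> G" unfolding K_def by (rule \<rho>\<^sub>1.normal_kernel)
  interpret K: normal K G by (rule K)

  \<comment> \<open>With constant \<open>\<xi>\<close> the \<open>F\<close>-component never changes,
    so \<open>\<rho>\<^sub>1\<close> is the action on the central product. Different indices move
    different coordinates, and their contributions to the \<open>C\<close>-component commute because
    \<open>C\<close> is abelian.\<close>
  have comm: "\<rho>\<^sub>1 (\<iota> i a) \<otimes>\<^bsub>BijGroup (states F)\<^esub> \<rho>\<^sub>1 (\<iota> j b) = \<rho>\<^sub>1 (\<iota> j b) \<otimes>\<^bsub>BijGroup (states F)\<^esub> \<rho>\<^sub>1 (\<iota> i a)"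
    if ij: "i \<in> I" "j \<in> I" "i \<noteq> j" and a: "a \<in> carrier (A i)" and b: "b \<in> carrier (A j)" for i j a b
  proof (rule BijGroup_eqI)
    have \<iota>: "\<iota> i a \<in> carrier G" "\<iota> j b \<in> carrier G" using ij a b by (auto intro: \<iota>_closed)
    then show "\<rho>\<^sub>1 (\<iota> i a) \<otimes>\<^bsub>BijGroup (states F)\<^esub> \<rho>\<^sub>1 (\<iota> j b) \<in> carrier (BijGroup (states F))"
      "\<rho>\<^sub>1 (\<iota> j b) \<otimes>\<^bsub>BijGroup (states F)\<^esub> \<rho>\<^sub>1 (\<iota> i a) \<in> carrier (BijGroup (states F))"
      by auto
    fix s assume s: "s \<in> states F"
    obtain q c f where qcf: "s = (q, c, f)" "q \<in> coords" "c \<in> carrier C" "f \<in> carrier F"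
      using s by (auto simp: states_def)
    interpret Ai: group "A i" using group_A[OF ij(1)] .
    interpret Aj: group "A j" using group_A[OF ij(2)] .
    have ks: "\<kappa> i (a \<otimes>\<^bsub>A i\<^esub> q i) \<in> carrier C" "\<kappa> j (b \<otimes>\<^bsub>A j\<^esub> q j) \<in> carrier C"
      using ij a b coordsD(1)[OF qcf(2)] \<kappa>_closed by auto
    have "\<kappa> i (a \<otimes>\<^bsub>A i\<^esub> q i) \<otimes>\<^bsub>C\<^esub> (\<kappa> j (b \<otimes>\<^bsub>A j\<^esub> q j) \<otimes>\<^bsub>C\<^esub> c)
        = \<kappa> j (b \<otimes>\<^bsub>A j\<^esub> q j) \<otimes>\<^bsub>C\<^esub> (\<kappa> i (a \<otimes>\<^bsub>A i\<^esub> q i) \<otimes>\<^bsub>C\<^esub> c)"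
      using C_commute[OF ij(1) ks] ks qcf(3) by (simp flip: C.m_assoc)
    then have "move F (\<lambda>_ _. \<one>\<^bsub>F\<^esub>) i a (move F (\<lambda>_ _. \<one>\<^bsub>F\<^esub>) j b s)
        = move F (\<lambda>_ _. \<one>\<^bsub>F\<^esub>) j b (move F (\<lambda>_ _. \<one>\<^bsub>F\<^esub>) i a s)"
      using ij(3) qcf(4) by (simp add: qcf(1) move_def fun_upd_twist)
    then have "\<rho>\<^sub>1 (\<iota> i a) (\<rho>\<^sub>1 (\<iota> j b) s) = \<rho>\<^sub>1 (\<iota> j b) (\<rho>\<^sub>1 (\<iota> i a) s)"
      using \<rho>\<^sub>1_move[OF ij(1) a] \<rho>\<^sub>1_move[OF ij(2) b] \<rho>\<^sub>1_closed[OF \<iota>(1) s] \<rho>\<^sub>1_closed[OF \<iota>(2) s] s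
      by simp
    then show "(\<rho>\<^sub>1 (\<iota> i a) \<otimes>\<^bsub>BijGroup (states F)\<^esub> \<rho>\<^sub>1 (\<iota> j b)) s
        = (\<rho>\<^sub>1 (\<iota> j b) \<otimes>\<^bsub>BijGroup (states F)\<^esub> \<rho>\<^sub>1 (\<iota> i a)) s"
      using \<iota> s by (simp add: BijGroup_mult_apply)
  qed

  have "nilpotent_group (G Mod K)"
  proof -
    interpret \<pi>: group_hom G "G Mod K" "\<lambda>x. K #>\<^bsub>G\<^esub> x"
      using K.r_coset_hom_Mod K.factorgroup_is_group G.is_group
      by (simp add: group_hom_def group_hom_axioms_def)
    have "lower_central_series (G Mod K) n = {\<one>\<^bsub>G Mod K\<^esub>}"
    proof (rule \<pi>.H.lower_central_series_commuting_factors[where I = I and A = A and f = "\<lambda>i a. K #>\<^bsub>G\<^esub> \<iota> i a"])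
      show "(\<lambda>a. K #>\<^bsub>G\<^esub> \<iota> i a) \<in> hom (A i) (G Mod K)" if "i \<in> I" for i
        using hom_compose[OF \<iota>_hom[OF that] \<pi>.homh] by (simp add: comp_def)
      have B: "(\<Union>i\<in>I. \<iota> i ` carrier (A i)) \<subseteq> carrier G" using \<iota>_closed by auto
      have "carrier G = generate G (\<Union>i\<in>I. \<iota> i ` carrier (A i))"
        using group_A \<phi>_hom by (rule generalized_free_product_generated)
      with \<pi>.generate_img[OF B]
      show "carrier (G Mod K) = generate (G Mod K) (\<Union>i\<in>I. (\<lambda>a. K #>\<^bsub>G\<^esub> \<iota> i a) ` carrier (A i))"
        by (simp add: image_UN image_image carrier_FactGroup)
      show "(K #>\<^bsub>G\<^esub> \<iota> i a) \<otimes>\<^bsub>G Mod K\<^esub> (K #>\<^bsub>G\<^esub> \<iota> j b) = (K #>\<^bsub>G\<^esub> \<iota> j b) \<otimes>\<^bsub>G Mod K\<^esub> (K #>\<^bsub>G\<^esub> \<iota> i a)"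
        if ij: "i \<in> I" "j \<in> I" "i \<noteq> j" "a \<in> carrier (A i)" "b \<in> carrier (A j)" for i j a b
      proof -
        have \<iota>: "\<iota> i a \<in> carrier G" "\<iota> j b \<in> carrier G" using ij by (auto intro: \<iota>_closed)
        have "\<iota> i a \<otimes>\<^bsub>G\<^esub> \<iota> j b \<otimes>\<^bsub>G\<^esub> inv\<^bsub>G\<^esub> \<iota> i a \<otimes>\<^bsub>G\<^esub> inv\<^bsub>G\<^esub> \<iota> j b
            = (\<iota> i a \<otimes>\<^bsub>G\<^esub> \<iota> j b) \<otimes>\<^bsub>G\<^esub> inv\<^bsub>G\<^esub> (\<iota> j b \<otimes>\<^bsub>G\<^esub> \<iota> i a)"
          using \<iota> by (simp add: G.inv_mult_group G.m_assoc)
        then have "\<rho>\<^sub>1 (\<iota> i a \<otimes>\<^bsub>G\<^esub> \<iota> j b \<otimes>\<^bsub>G\<^esub> inv\<^bsub>G\<^esub> \<iota> i a \<otimes>\<^bsub>G\<^esub> inv\<^bsub>G\<^esub> \<iota> j b) = \<one>\<^bsub>BijGroup (states F)\<^esub>"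
          using \<iota> comm[OF ij] by (simp del: \<rho>\<^sub>1.hom_inv add: \<rho>\<^sub>1.hom_inv[of "\<iota> j b \<otimes>\<^bsub>G\<^esub> \<iota> i a"])
        moreover have "\<iota> i a \<otimes>\<^bsub>G\<^esub> \<iota> j b \<otimes>\<^bsub>G\<^esub> inv\<^bsub>G\<^esub> \<iota> i a \<otimes>\<^bsub>G\<^esub> inv\<^bsub>G\<^esub> \<iota> j b \<in> carrier G"
          using \<iota> by simp
        ultimately have "\<iota> i a \<otimes>\<^bsub>G\<^esub> \<iota> j b \<otimes>\<^bsub>G\<^esub> inv\<^bsub>G\<^esub> \<iota> i a \<otimes>\<^bsub>G\<^esub> inv\<^bsub>G\<^esub> \<iota> j b \<in> K"
          unfolding K_def kernel_def by blast
        then show ?thesis using K.commutator_mem_iff[OF \<iota>] by simp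
      qed
    qed (use group_A nilp in auto)
    then show ?thesis
      using K.factorgroup_is_group by (auto simp: nilpotent_group_def)
  qed

  \<comment> \<open>The homomorphism from the free group into \<open>K\<close>\<close>
  obtain \<beta> where \<beta>: "\<beta> \<in> hom F G" and \<beta>_gen: "\<And>s. s \<in> basis \<Longrightarrow> \<beta> (free_gen basis s) = s"
    using free_group_universal[of G "\<lambda>s. s" basis] basis_closed G.is_group by blast
  interpret \<beta>: group_hom F G \<beta>
    using \<beta> F.is_group G.is_group by (simp add: group_hom_def group_hom_axioms_def)
  have \<beta>_\<xi>: "\<beta> (\<xi> q i) = schreier q i" if "q \<in> coords" "i \<in> I" for q i
  proof (cases "schreier q i = \<one>\<^bsub>G\<^esub>")
    case False
    then have "schreier q i \<in> basis" using that unfolding basis_def by blast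
    with False show ?thesis using \<beta>_gen by (simp add: \<xi>_def)
  qed (simp add: \<xi>_def)
  have gens: "free_gen basis ` basis \<subseteq> carrier F" by (auto intro: free_gen_closed)

  \<comment> \<open>The factors commute under \<open>\<rho>\<^sub>1\<close>, so every Schreier
    generator acts trivially.\<close>
  have "basis \<subseteq> K"
    using schreier_trivial_if_factors_commute[OF \<rho>\<^sub>1.group_hom_axioms comm] schreier_closed
    unfolding basis_def K_def kernel_def by blast
  then have "generate G basis \<subseteq> K" using G.generate_subgroup_incl K.subgroup_axioms by blast
  moreover have "\<beta> ` free_gen basis ` basis = basis" using \<beta>_gen by force
  ultimately have \<beta>_K: "\<beta> ` carrier F \<subseteq> K"
    using \<beta>.generate_img[OF gens] by (simp flip: free_group_generated)

  \<comment> \<open>The orbit of the base point and injectivity\<close>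
  have st: "(q, c, f) \<in> states F" if "q \<in> coords" "c \<in> carrier C" "f \<in> carrier F" for q c f
    using that by (simp add: states_def)
  \<comment> \<open>The tree path leads from \<open>neutral\<close> to \<open>q\<close>; its edges
    carry trivial labels, so the other two components are untouched.\<close>
  have \<rho>_\<tau>: "\<rho> (\<tau> q) (neutral, c, f) = (q, c, f)"
    if "q \<in> coords" and c: "c \<in> carrier C" and f: "f \<in> carrier F" for q c f
    using that(1)
  proof (induction rule: coords_induct)
    case neutral
    show ?case unfolding \<tau>_neutral by (rule \<rho>_one[OF st[OF neutral_coords c f]])
  next
    case (step q)
    define l where "l = lead q"
    have l: "l \<in> I" using lead_in(2)[OF step(1,2)] by (simp add: l_def)
    interpret Al: group "A l" using group_A[OF l] .
    note ql = coordsD[OF step(1) l] and cl = clear_coords[OF step(1) l]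
    have "\<rho> (\<tau> q) (neutral, c, f) = \<rho> (\<iota> l (q l)) (clear q l, c, f)"
      using \<rho>_mult[OF \<iota>_closed[OF l ql(1)] \<tau>_closed[OF cl] st[OF neutral_coords c f]] step.IH
        \<tau>_lead[OF step(1,2)] unfolding l_def by metis
    also have "\<dots> = move F \<xi> l (q l) (clear q l, c, f)"
      by (rule \<rho>_move[OF l ql(1) st[OF cl c f]])
    also have "\<dots> = (q, c, f)"
      using ql c f \<kappa>_rep[OF l ql] schreier_lead[OF step(1,2)] schreier_clear[OF step(1) l]
      by (simp add: move_def \<xi>_def flip: l_def)
    finally show ?case .
  qed

  \<comment> \<open>Along the loop, only the middle edge has a label that can be nontrivial, and
    this is what multiplies the \<open>F\<close>-component.\<close>
  have \<rho>_schreier: "\<rho> (schreier q i) (neutral, \<one>\<^bsub>C\<^esub>, f) = (neutral, \<one>\<^bsub>C\<^esub>, \<xi> q i \<otimes>\<^bsub>F\<^esub> f)"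
    if q: "q \<in> coords" and i: "i \<in> I" and f: "f \<in> carrier F" for q i f
  proof -
    interpret Ai: group "A i" using group_A[OF i] .
    note qi = coordsD[OF q i] and ci = clear_coords[OF q i]
    have \<iota>: "\<iota> i (q i) \<in> carrier G" using qi i by (auto intro: \<iota>_closed)
    have sts: "(neutral, \<one>\<^bsub>C\<^esub>, f) \<in> states F" "(clear q i, \<one>\<^bsub>C\<^esub>, f) \<in> states F"
      "(neutral, \<one>\<^bsub>C\<^esub>, \<xi> q i \<otimes>\<^bsub>F\<^esub> f) \<in> states F"
      using neutral_coords ci f \<xi>_closed[OF q i] by (auto intro!: st)
    have "\<rho> (schreier q i) (neutral, \<one>\<^bsub>C\<^esub>, f) = \<rho> (inv\<^bsub>G\<^esub> \<tau> q) (\<rho> (\<iota> i (q i)) (clear q i, \<one>\<^bsub>C\<^esub>, f))"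
      unfolding schreier_def using \<rho>_\<tau>[OF ci C.one_closed f] \<tau>_closed[OF q] \<tau>_closed[OF ci] \<iota> sts
      by (simp add: BijGroup_mult_apply BijGroup_closed)
    also have "\<rho> (\<iota> i (q i)) (clear q i, \<one>\<^bsub>C\<^esub>, f) = (q, \<one>\<^bsub>C\<^esub>, \<xi> q i \<otimes>\<^bsub>F\<^esub> f)"
      using \<rho>_move[OF i qi(1) sts(2)] qi f \<kappa>_rep[OF i qi] schreier_clear[OF q i]
      by (simp add: move_def \<xi>_def[of "clear q i"])
    also have "\<rho> (inv\<^bsub>G\<^esub> \<tau> q) (q, \<one>\<^bsub>C\<^esub>, \<xi> q i \<otimes>\<^bsub>F\<^esub> f) = (neutral, \<one>\<^bsub>C\<^esub>, \<xi> q i \<otimes>\<^bsub>F\<^esub> f)"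
      using \<rho>_\<tau>[OF q] \<xi>_closed[OF q i] f by (intro \<rho>_inv \<tau>_closed q sts) simp_all
    finally show ?thesis .
  qed

  \<comment> \<open>Over \<open>(neutral, \<one>)\<close> the image of \<open>w\<close> acts as left
    translation by \<open>w\<close>. Thus \<open>w\<close> can be read off from
    \<open>\<beta> w\<close>, which is injectivity.\<close>
  have \<rho>_\<beta>: "\<rho> (\<beta> w) (neutral, \<one>\<^bsub>C\<^esub>, f) = (neutral, \<one>\<^bsub>C\<^esub>, w \<otimes>\<^bsub>F\<^esub> f)"
    if w: "w \<in> carrier F" and f: "f \<in> carrier F" for w f
  proof -
    note st = st[OF neutral_coords C.one_closed]
    have gen: "\<rho> s (neutral, \<one>\<^bsub>C\<^esub>, f) = (neutral, \<one>\<^bsub>C\<^esub>, free_gen basis s \<otimes>\<^bsub>F\<^esub> f)"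
      if s: "s \<in> basis" and f: "f \<in> carrier F" for s f
    proof -
      obtain q i where "q \<in> coords" "i \<in> I" "s = schreier q i" "s \<noteq> \<one>\<^bsub>G\<^esub>"
        using s unfolding basis_def by blast
      then show ?thesis using \<rho>_schreier[of q i f] f by (simp only: \<xi>_def if_False)
    qed
    have "w \<in> generate F (free_gen basis ` basis)" using w by (simp flip: free_group_generated)
    then have "\<forall>f \<in> carrier F. \<rho> (\<beta> w) (neutral, \<one>\<^bsub>C\<^esub>, f) = (neutral, \<one>\<^bsub>C\<^esub>, w \<otimes>\<^bsub>F\<^esub> f)"
    proof (induction rule: generate.induct)
      case one
      show ?case using st by (simp add: BijGroup_one_apply)
    next
      case (incl h)
      then show ?case using gen \<beta>_gen by auto
    next
      case (inv h)
      then obtain s where s: "s \<in> basis" "h = free_gen basis s" by blast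
      then have h: "h \<in> carrier F" "\<beta> h = s" "s \<in> carrier G"
        using free_gen_closed \<beta>_gen basis_closed by auto
      show ?case
      proof
        fix f assume f: "f \<in> carrier F"
        have "\<rho> s (neutral, \<one>\<^bsub>C\<^esub>, inv\<^bsub>F\<^esub> h \<otimes>\<^bsub>F\<^esub> f) = (neutral, \<one>\<^bsub>C\<^esub>, f)"
          using gen[OF s(1), of "inv\<^bsub>F\<^esub> h \<otimes>\<^bsub>F\<^esub> f"] f h(1) s(2) by (simp flip: F.m_assoc)
        then show "\<rho> (\<beta> (inv\<^bsub>F\<^esub> h)) (neutral, \<one>\<^bsub>C\<^esub>, f) = (neutral, \<one>\<^bsub>C\<^esub>, inv\<^bsub>F\<^esub> h \<otimes>\<^bsub>F\<^esub> f)"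
          using \<rho>_inv[OF h(3) st] h f by (simp only: \<beta>.hom_inv F.inv_closed F.m_closed)
      qed
    next
      case (eng h1 h2)
      have "h1 \<in> carrier F" "h2 \<in> carrier F" using eng by (auto simp: free_group_generated)
      then show ?case using eng st by (simp add: BijGroup_mult_apply F.m_assoc)
    qed
    with f show ?thesis by blast
  qed

  have inj: "inj_on \<beta> (carrier F)"
  proof (rule inj_onI)
    fix v w assume vw: "v \<in> carrier F" "w \<in> carrier F" "\<beta> v = \<beta> w"
    have "(neutral, \<one>\<^bsub>C\<^esub>, v \<otimes>\<^bsub>F\<^esub> \<one>\<^bsub>F\<^esub>) = \<rho> (\<beta> v) (neutral, \<one>\<^bsub>C\<^esub>, \<one>\<^bsub>F\<^esub>)"
      by (rule \<rho>_\<beta>[OF vw(1) F.one_closed, symmetric])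
    also have "\<dots> = (neutral, \<one>\<^bsub>C\<^esub>, w \<otimes>\<^bsub>F\<^esub> \<one>\<^bsub>F\<^esub>)"
      unfolding vw(3) by (rule \<rho>_\<beta>[OF vw(2) F.one_closed])
    finally show "v = w" using vw(1,2) by simp
  qed

  \<comment> \<open>Reconstruction of group elements and surjectivity onto \<open>K\<close>\<close>
  define \<psi> where "\<psi> = (\<lambda>(q, c, f). \<tau> q \<otimes>\<^bsub>G\<^esub> (\<zeta> c \<otimes>\<^bsub>G\<^esub> \<beta> f))"
  \<comment> \<open>\<open>\<psi>\<close> intertwines the action with left multiplication. The
    labels in \<open>move\<close> become Schreier generators under \<open>\<beta>\<close>, these
    cancel against the change from \<open>\<tau> q\<close> to \<open>\<tau> q'\<close>, and
    centrality of \<open>\<zeta>\<close> collects the \<open>C\<close>-parts.\<close>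
  have \<psi>_move: "\<psi> (move F \<xi> i a s) = \<iota> i a \<otimes>\<^bsub>G\<^esub> \<psi> s"
    if i: "i \<in> I" and a: "a \<in> carrier (A i)" and s: "s \<in> states F" for i a s
  proof -
    interpret Ai: group "A i" using group_A[OF i] .
    obtain q c f where s: "s = (q, c, f)" "q \<in> coords" "c \<in> carrier C" "f \<in> carrier F"
      using s by (auto simp: states_def)
    note q = s(2)
    note qi = coordsD[OF q i]
    have aq: "a \<otimes>\<^bsub>A i\<^esub> q i \<in> carrier (A i)" using qi a by simp
    define p where "p = r i (a \<otimes>\<^bsub>A i\<^esub> q i)"
    define k where "k = \<kappa> i (a \<otimes>\<^bsub>A i\<^esub> q i)"
    define q' where "q' = q(i := p)"
    \<comment> \<open>Clearing coordinate \<open>i\<close> erases the difference between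
      \<open>q\<close> and \<open>q'\<close>, so the same \<open>u\<close> occurs in the identities
      for both Schreier generators.\<close>
    define u where "u = \<tau> (clear q i)"
    have p: "p \<in> carrier (A i)" "r i p = p" and k: "k \<in> carrier C"
      using aq i r_closed r_r \<kappa>_closed by (auto simp: p_def k_def)
    have q': "q' \<in> coords" unfolding q'_def by (rule coords_upd[OF q i p])
    have u: "u \<in> carrier G" unfolding u_def by (rule \<tau>_closed[OF clear_coords[OF q i]])
    have cl: "\<tau> q \<in> carrier G" "\<tau> q' \<in> carrier G" "\<beta> f \<in> carrier G" "\<zeta> c \<in> carrier G" "\<zeta> k \<in> carrier G"
      "\<iota> i a \<in> carrier G" "\<iota> i p \<in> carrier G" "\<iota> i (q i) \<in> carrier G"
      "schreier q i \<in> carrier G" "schreier q' i \<in> carrier G" "\<xi> q i \<in> carrier F" "\<xi> q' i \<in> carrier F"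
      using q q' s(3,4) k i a p qi
      by (auto intro: \<tau>_closed \<zeta>_closed \<iota>_closed schreier_closed \<xi>_closed)
    have e1: "\<tau> q' \<otimes>\<^bsub>G\<^esub> schreier q' i = \<iota> i p \<otimes>\<^bsub>G\<^esub> u"
      using \<tau>_schreier[OF q' i] by (simp add: q'_def u_def)
    have "\<tau> q \<otimes>\<^bsub>G\<^esub> schreier q i = \<iota> i (q i) \<otimes>\<^bsub>G\<^esub> u"
      using \<tau>_schreier[OF q i] by (simp add: u_def)
    then have "inv\<^bsub>G\<^esub> \<iota> i (q i) \<otimes>\<^bsub>G\<^esub> (\<tau> q \<otimes>\<^bsub>G\<^esub> schreier q i) \<otimes>\<^bsub>G\<^esub> inv\<^bsub>G\<^esub> schreier q i
        = inv\<^bsub>G\<^esub> \<iota> i (q i) \<otimes>\<^bsub>G\<^esub> (\<iota> i (q i) \<otimes>\<^bsub>G\<^esub> u) \<otimes>\<^bsub>G\<^esub> inv\<^bsub>G\<^esub> schreier q i"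
      by (rule arg_cong)
    moreover have "inv\<^bsub>G\<^esub> \<iota> i (q i) \<otimes>\<^bsub>G\<^esub> (\<iota> i (q i) \<otimes>\<^bsub>G\<^esub> u) = u"
      using cl u by (simp flip: G.m_assoc)
    moreover have "inv\<^bsub>G\<^esub> \<iota> i (q i) \<otimes>\<^bsub>G\<^esub> (\<tau> q \<otimes>\<^bsub>G\<^esub> schreier q i) \<otimes>\<^bsub>G\<^esub> inv\<^bsub>G\<^esub> schreier q i
        = inv\<^bsub>G\<^esub> \<iota> i (q i) \<otimes>\<^bsub>G\<^esub> \<tau> q"
      using cl by (simp add: G.m_assoc)
    ultimately have e2: "u \<otimes>\<^bsub>G\<^esub> inv\<^bsub>G\<^esub> schreier q i = inv\<^bsub>G\<^esub> \<iota> i (q i) \<otimes>\<^bsub>G\<^esub> \<tau> q"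
      by simp
    have "p \<otimes>\<^bsub>A i\<^esub> \<phi> i k = a \<otimes>\<^bsub>A i\<^esub> q i" using r_\<kappa>[OF i aq] by (simp add: p_def k_def)
    then have e3: "\<iota> i p \<otimes>\<^bsub>G\<^esub> \<zeta> k = \<iota> i a \<otimes>\<^bsub>G\<^esub> \<iota> i (q i)"
      using \<iota>_mult[OF i p(1) \<phi>_closed[OF i k]] \<iota>_mult[OF i a qi(1)] by (simp add: \<zeta>_eq[OF i k])
    have "\<psi> (move F \<xi> i a s)
        = \<tau> q' \<otimes>\<^bsub>G\<^esub> (\<zeta> (k \<otimes>\<^bsub>C\<^esub> c) \<otimes>\<^bsub>G\<^esub> \<beta> (\<xi> q' i \<otimes>\<^bsub>F\<^esub> (inv\<^bsub>F\<^esub> \<xi> q i \<otimes>\<^bsub>F\<^esub> f)))"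
      by (simp add: \<psi>_def move_def s(1) q'_def p_def k_def)
    also have "\<beta> (\<xi> q' i \<otimes>\<^bsub>F\<^esub> (inv\<^bsub>F\<^esub> \<xi> q i \<otimes>\<^bsub>F\<^esub> f))
        = schreier q' i \<otimes>\<^bsub>G\<^esub> (inv\<^bsub>G\<^esub> schreier q i \<otimes>\<^bsub>G\<^esub> \<beta> f)"
      using cl s(4) \<beta>_\<xi>[OF q i] \<beta>_\<xi>[OF q' i] by simp
    also have "\<tau> q' \<otimes>\<^bsub>G\<^esub> (\<zeta> (k \<otimes>\<^bsub>C\<^esub> c) \<otimes>\<^bsub>G\<^esub> (schreier q' i \<otimes>\<^bsub>G\<^esub> (inv\<^bsub>G\<^esub> schreier q i \<otimes>\<^bsub>G\<^esub> \<beta> f)))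
        = \<zeta> (k \<otimes>\<^bsub>C\<^esub> c) \<otimes>\<^bsub>G\<^esub> (\<tau> q' \<otimes>\<^bsub>G\<^esub> schreier q' i \<otimes>\<^bsub>G\<^esub> (inv\<^bsub>G\<^esub> schreier q i \<otimes>\<^bsub>G\<^esub> \<beta> f))"
      using \<zeta>_central[OF cl(2), of "k \<otimes>\<^bsub>C\<^esub> c"] \<zeta>_closed[of "k \<otimes>\<^bsub>C\<^esub> c"] k s(3) cl
      by (simp flip: G.m_assoc)
    also have "\<dots> = \<zeta> (k \<otimes>\<^bsub>C\<^esub> c) \<otimes>\<^bsub>G\<^esub> (\<iota> i p \<otimes>\<^bsub>G\<^esub> ((u \<otimes>\<^bsub>G\<^esub> inv\<^bsub>G\<^esub> schreier q i) \<otimes>\<^bsub>G\<^esub> \<beta> f))"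
      unfolding e1 using cl u by (simp add: G.m_assoc)
    also have "\<dots> = \<zeta> k \<otimes>\<^bsub>G\<^esub> \<zeta> c \<otimes>\<^bsub>G\<^esub> (\<iota> i p \<otimes>\<^bsub>G\<^esub> (inv\<^bsub>G\<^esub> \<iota> i (q i) \<otimes>\<^bsub>G\<^esub> \<tau> q \<otimes>\<^bsub>G\<^esub> \<beta> f))"
      unfolding e2 \<zeta>_mult[OF i k s(3)] ..
    also have "\<dots> = (\<zeta> k \<otimes>\<^bsub>G\<^esub> \<iota> i p) \<otimes>\<^bsub>G\<^esub> (inv\<^bsub>G\<^esub> \<iota> i (q i) \<otimes>\<^bsub>G\<^esub> (\<tau> q \<otimes>\<^bsub>G\<^esub> (\<zeta> c \<otimes>\<^bsub>G\<^esub> \<beta> f)))"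
    proof -
      have "\<zeta> c \<otimes>\<^bsub>G\<^esub> (\<iota> i p \<otimes>\<^bsub>G\<^esub> (inv\<^bsub>G\<^esub> \<iota> i (q i) \<otimes>\<^bsub>G\<^esub> \<tau> q)) = \<iota> i p \<otimes>\<^bsub>G\<^esub> (inv\<^bsub>G\<^esub> \<iota> i (q i) \<otimes>\<^bsub>G\<^esub> \<tau> q) \<otimes>\<^bsub>G\<^esub> \<zeta> c"
        using cl s(3) by (intro \<zeta>_central) simp_all
      then have "\<zeta> c \<otimes>\<^bsub>G\<^esub> (\<iota> i p \<otimes>\<^bsub>G\<^esub> (inv\<^bsub>G\<^esub> \<iota> i (q i) \<otimes>\<^bsub>G\<^esub> \<tau> q)) \<otimes>\<^bsub>G\<^esub> \<beta> f
          = \<iota> i p \<otimes>\<^bsub>G\<^esub> (inv\<^bsub>G\<^esub> \<iota> i (q i) \<otimes>\<^bsub>G\<^esub> \<tau> q) \<otimes>\<^bsub>G\<^esub> \<zeta> c \<otimes>\<^bsub>G\<^esub> \<beta> f" by simp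
      then show ?thesis using cl by (simp add: G.m_assoc)
    qed
    also have "\<zeta> k \<otimes>\<^bsub>G\<^esub> \<iota> i p = \<iota> i a \<otimes>\<^bsub>G\<^esub> \<iota> i (q i)"
      using \<zeta>_central[OF cl(7) k] e3 by simp
    also have "\<iota> i a \<otimes>\<^bsub>G\<^esub> \<iota> i (q i) \<otimes>\<^bsub>G\<^esub> (inv\<^bsub>G\<^esub> \<iota> i (q i) \<otimes>\<^bsub>G\<^esub> (\<tau> q \<otimes>\<^bsub>G\<^esub> (\<zeta> c \<otimes>\<^bsub>G\<^esub> \<beta> f)))
        = \<iota> i a \<otimes>\<^bsub>G\<^esub> \<psi> s"
      using cl by (simp add: \<psi>_def s(1) G.m_assoc G.inv_solve_left flip: G.m_assoc[of "\<iota> i (q i)" "inv\<^bsub>G\<^esub> \<iota> i (q i)"])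
    finally show ?thesis .
  qed

  let ?base = "(neutral, \<one>\<^bsub>C\<^esub>, \<one>\<^bsub>F\<^esub>)"
  have base: "?base \<in> states F" using neutral_coords by (simp add: states_def)
  have \<psi>_orbit: "\<psi> (\<rho> g ?base) = g" if "g \<in> carrier G" for g
    using that
  proof (induction rule: G_induct)
    case one
    show ?case unfolding \<rho>_one[OF base] by (simp add: \<psi>_def \<tau>_neutral \<zeta>_one)
  next
    case (mult i a g)
    then show ?case
      using \<rho>_move[OF mult(1,2) \<rho>_closed[OF mult(3) base]] \<psi>_move[OF mult(1,2) \<rho>_closed[OF mult(3) base]]
        \<rho>_mult[OF \<iota>_closed[OF mult(1,2)] mult(3) base] by (simp only:)
  qed
  \<comment> \<open>The two actions differ only in the \<open>F\<close>-component, which has no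
    influence on the other two.\<close>
  have project: "fst (\<rho> g s) = fst (\<rho>\<^sub>1 g s) \<and> fst (snd (\<rho> g s)) = fst (snd (\<rho>\<^sub>1 g s))"
    if "g \<in> carrier G" and s: "s \<in> states F" for g s
    using that(1)
  proof (induction rule: G_induct)
    case one
    show ?case by (simp only: \<rho>_one[OF s] \<rho>\<^sub>1_one[OF s])
  next
    case (mult i a g)
    then show ?case
      using \<rho>_move[OF mult(1,2) \<rho>_closed[OF mult(3) s]] \<rho>\<^sub>1_move[OF mult(1,2) \<rho>\<^sub>1_closed[OF mult(3) s]]
        \<rho>_mult[OF \<iota>_closed[OF mult(1,2)] mult(3) s] \<rho>\<^sub>1_mult[OF \<iota>_closed[OF mult(1,2)] mult(3) s]
      by (simp only:) (simp add: move_def split: prod.splits)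
  qed
  \<comment> \<open>An element of \<open>K\<close> returns the base point to \<open>neutral\<close>
    and to the identity of \<open>C\<close>, so \<open>\<psi>\<close> reconstructs it from its
    \<open>F\<close>-component alone.\<close>
  have "K \<subseteq> \<beta> ` carrier F"
  proof
    fix g assume "g \<in> K"
    then have g: "g \<in> carrier G" "\<rho>\<^sub>1 g = \<one>\<^bsub>BijGroup (states F)\<^esub>" unfolding K_def kernel_def by blast+
    obtain q c f where qcf: "\<rho> g ?base = (q, c, f)" by (cases "\<rho> g ?base")
    then have f: "f \<in> carrier F" using \<rho>_closed[OF g(1) base] by (simp add: states_def)
    have "q = neutral" "c = \<one>\<^bsub>C\<^esub>"
      using project[OF g(1) base] unfolding qcf g(2) BijGroup_one_apply[OF base] by simp_all
    then have "g = \<beta> f"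
      using \<psi>_orbit[OF g(1)] qcf f by (simp add: \<psi>_def \<tau>_neutral \<zeta>_one)
    with f show "g \<in> \<beta> ` carrier F" by blast
  qed
  with \<beta>_K inj have "\<beta> \<in> iso F (G\<lparr>carrier := K\<rparr>)"
    by (auto simp: iso_def bij_betw_def hom_def)
  with K \<open>nilpotent_group (G Mod K)\<close> show thesis by (rule that)
qed

end

text \<open>\<open>r a\<close> depends on \<open>a\<close> only through the coset
  \<open>D a\<close>, which makes it constant on cosets; \<open>\<kappa> a\<close> is the element of
  \<open>C\<close> leading from \<open>r a\<close> back to \<open>a\<close>.\<close>

lemma coset_representatives:
  assumes "group A" "group C" and \<phi>: "\<phi> \<in> mon C A"
  shows "\<exists>r \<kappa>. (\<forall>a \<in> carrier A. r a \<in> carrier A \<and> \<kappa> a \<in> carrier C \<and> r a \<otimes>\<^bsub>A\<^esub> \<phi> (\<kappa> a) = a \<and>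
      (\<forall>c \<in> carrier C. r (a \<otimes>\<^bsub>A\<^esub> \<phi> c) = r a)) \<and> r \<one>\<^bsub>A\<^esub> = \<one>\<^bsub>A\<^esub>"
proof -
  interpret A: group A by fact
  interpret C: group C by fact
  interpret \<phi>: group_hom C A \<phi>
    using \<phi> by unfold_locales (simp add: mon_def)
  define D where "D a = {b. \<exists>c \<in> carrier C. b = a \<otimes>\<^bsub>A\<^esub> \<phi> c}" for a
  \<comment> \<open>The coset of the identity must be represented by the identity, so that
    \<open>neutral\<close> and the cleared vectors are coordinate vectors.\<close>
  define r where "r a = (if \<one>\<^bsub>A\<^esub> \<in> D a then \<one>\<^bsub>A\<^esub> else SOME b. b \<in> D a)" for a
  have D_self: "a \<in> D a" if "a \<in> carrier A" for a
    unfolding D_def using that by (auto intro!: bexI[of _ "\<one>\<^bsub>C\<^esub>"])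
  have r_D: "r a \<in> D a" if "a \<in> carrier A" for a
    using someI[of "\<lambda>b. b \<in> D a", OF D_self[OF that]] by (simp add: r_def)
  have D_mult: "D (a \<otimes>\<^bsub>A\<^esub> \<phi> c) = D a" if a: "a \<in> carrier A" and c: "c \<in> carrier C" for a c
  proof
    show "D (a \<otimes>\<^bsub>A\<^esub> \<phi> c) \<subseteq> D a"
    proof
      fix b assume "b \<in> D (a \<otimes>\<^bsub>A\<^esub> \<phi> c)"
      then obtain d where d: "d \<in> carrier C" "b = a \<otimes>\<^bsub>A\<^esub> \<phi> c \<otimes>\<^bsub>A\<^esub> \<phi> d" by (auto simp: D_def)
      then have "b = a \<otimes>\<^bsub>A\<^esub> \<phi> (c \<otimes>\<^bsub>C\<^esub> d)" using a c by (simp add: A.m_assoc)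
      then show "b \<in> D a" using c d(1) unfolding D_def by blast
    qed
    show "D a \<subseteq> D (a \<otimes>\<^bsub>A\<^esub> \<phi> c)"
    proof
      fix b assume "b \<in> D a"
      then obtain d where d: "d \<in> carrier C" "b = a \<otimes>\<^bsub>A\<^esub> \<phi> d" by (auto simp: D_def)
      have "\<phi> c \<otimes>\<^bsub>A\<^esub> \<phi> (inv\<^bsub>C\<^esub> c \<otimes>\<^bsub>C\<^esub> d) = \<phi> d"
        using c d(1) by (simp flip: \<phi>.hom_mult C.m_assoc)
      then have "b = a \<otimes>\<^bsub>A\<^esub> \<phi> c \<otimes>\<^bsub>A\<^esub> \<phi> (inv\<^bsub>C\<^esub> c \<otimes>\<^bsub>C\<^esub> d)"
        using a c d by (simp add: A.m_assoc del: \<phi>.hom_mult)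
      then show "b \<in> D (a \<otimes>\<^bsub>A\<^esub> \<phi> c)" using c d(1) unfolding D_def by blast
    qed
  qed
  have "\<exists>d. d \<in> carrier C \<and> r a \<otimes>\<^bsub>A\<^esub> \<phi> d = a" if a: "a \<in> carrier A" for a
  proof -
    obtain c where c: "c \<in> carrier C" "r a = a \<otimes>\<^bsub>A\<^esub> \<phi> c" using r_D[OF a] by (auto simp: D_def)
    then have "r a \<otimes>\<^bsub>A\<^esub> \<phi> (inv\<^bsub>C\<^esub> c) = a" using a by (simp add: A.m_assoc)
    with c(1) show ?thesis by blast
  qed
  then obtain \<kappa> where \<kappa>: "\<And>a. a \<in> carrier A \<Longrightarrow> \<kappa> a \<in> carrier C \<and> r a \<otimes>\<^bsub>A\<^esub> \<phi> (\<kappa> a) = a"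
    by metis
  have "r a \<in> carrier A" if "a \<in> carrier A" for a using r_D[OF that] that by (auto simp: D_def)
  moreover have "r \<one>\<^bsub>A\<^esub> = \<one>\<^bsub>A\<^esub>" using D_self[of "\<one>\<^bsub>A\<^esub>"] by (simp add: r_def)
  moreover have "r (a \<otimes>\<^bsub>A\<^esub> \<phi> c) = r a" if "a \<in> carrier A" "c \<in> carrier C" for a c
    using D_mult[OF that] by (simp add: r_def)
  ultimately show ?thesis using \<kappa> by blast
qed

theorem theorem3:
  fixes I :: "'i set"
    and A :: "'i \<Rightarrow> 'a monoid"
    and C :: "'c monoid"
    and \<phi> :: "'i \<Rightarrow> 'c \<Rightarrow> 'a"
    and c :: nat
    and G :: "('i \<times> 'a) list set set monoid"
  assumes "\<And>i. i \<in> I \<Longrightarrow> finitely_generated_group (A i)"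
    and "\<And>i. i \<in> I \<Longrightarrow> nilpotent_group (A i)"
    and "\<And>i. i \<in> I \<Longrightarrow> nilpotency_class (A i) \<le> c"
    and "group C"
    and "\<And>i. i \<in> I \<Longrightarrow> \<phi> i \<in> mon C (A i)"
    and "\<And>i. i \<in> I \<Longrightarrow> \<phi> i ` carrier C \<subseteq> group_center (A i)"
    and "G = generalized_free_product I A C \<phi>"
  shows "(\<exists>(N :: ('i \<times> 'a) list set set monoid) (Q :: ('i \<times> 'a) list set set set monoid).
            is_free_group N \<and> nilpotent_group Q \<and> group_extension G N Q)
         \<and> residually_solvable G"
proof -
  have group_A: "group (A i)" if "i \<in> I" for i
    using assms(2)[OF that] by (simp add: nilpotent_group_def)
  have central: "\<phi> i d \<otimes>\<^bsub>A i\<^esub> a = a \<otimes>\<^bsub>A i\<^esub> \<phi> i d"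
    if "i \<in> I" "d \<in> carrier C" "a \<in> carrier (A i)" for i d a
    using assms(6)[OF that(1)] that by (auto simp: group_center_def)
  \<comment> \<open>The class of a factor is the first trivial term of its series; all later terms
    are trivial as well, so the bound \<open>c\<close> serves all factors.\<close>
  have nilp: "lower_central_series (A i) c = {\<one>\<^bsub>A i\<^esub>}" if "i \<in> I" for i
  proof -
    have "\<exists>n. lower_central_series (A i) n = {\<one>\<^bsub>A i\<^esub>}"
      using assms(2)[OF that] by (simp add: nilpotent_group_def)
    then have "lower_central_series (A i) (nilpotency_class (A i)) = {\<one>\<^bsub>A i\<^esub>}"
      unfolding nilpotency_class_def by (rule LeastI_ex)
    then show ?thesis
      using group.lower_central_series_trivial_mono[OF group_A[OF that] _ assms(3)[OF that]] by blast
  qed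
  have "\<forall>i\<in>I. \<exists>r \<kappa>. (\<forall>a \<in> carrier (A i). r a \<in> carrier (A i) \<and> \<kappa> a \<in> carrier C \<and>
      r a \<otimes>\<^bsub>A i\<^esub> \<phi> i (\<kappa> a) = a \<and> (\<forall>d \<in> carrier C. r (a \<otimes>\<^bsub>A i\<^esub> \<phi> i d) = r a)) \<and> r \<one>\<^bsub>A i\<^esub> = \<one>\<^bsub>A i\<^esub>"
    using coset_representatives group_A assms(4,5) by blast
  then obtain r \<kappa> where rk: "\<forall>i\<in>I. (\<forall>a \<in> carrier (A i). r i a \<in> carrier (A i) \<and> \<kappa> i a \<in> carrier C \<and>
      r i a \<otimes>\<^bsub>A i\<^esub> \<phi> i (\<kappa> i a) = a \<and> (\<forall>d \<in> carrier C. r i (a \<otimes>\<^bsub>A i\<^esub> \<phi> i d) = r i a)) \<and>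
      r i \<one>\<^bsub>A i\<^esub> = \<one>\<^bsub>A i\<^esub>"
    unfolding bchoice_iff by blast
  interpret central_amalgam I A C \<phi> r \<kappa>
    by (intro central_amalgam.intro) (use group_A assms(4,5) central rk in auto)
  obtain K \<beta> where K: "K \<lhd> generalized_free_product I A C \<phi>"
    and nil: "nilpotent_group (generalized_free_product I A C \<phi> Mod K)"
    and \<beta>: "\<beta> \<in> iso F (generalized_free_product I A C \<phi>\<lparr>carrier := K\<rparr>)"
    using free_by_nilpotent[OF nilp] by blast
  interpret K: normal K "generalized_free_product I A C \<phi>" by (rule K)
  let ?N = "G\<lparr>carrier := K\<rparr>"
  have N: "group ?N" unfolding assms(7) by (rule G.subgroup_imp_group[OF K.subgroup_axioms])
  \<comment> \<open>The required basis has to consist of elements of the type of \<open>G\<close>;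
    \<open>basis\<close> does, being a set of Schreier generators.\<close>
  moreover have "is_free_group ?N"
    unfolding is_free_group_def using N \<beta> by (auto simp: assms(7) is_iso_def)
  moreover have "group_extension G ?N (G Mod K)"
  proof -
    have "id \<in> mon ?N G" using K.subset by (auto simp: mon_def hom_def assms(7))
    moreover have "(\<lambda>x. K #>\<^bsub>G\<^esub> x) \<in> epi G (G Mod K)"
      using K.r_coset_hom_Mod by (simp add: epi_def carrier_FactGroup assms(7))
    moreover have "id ` carrier ?N = kernel G (G Mod K) (\<lambda>x. K #>\<^bsub>G\<^esub> x)"
      using G.coset_join1[OF _ _ K.subgroup_axioms] K.rcos_const[OF G.is_group] K.subset
      by (auto simp: kernel_def assms(7))
    ultimately show ?thesis
      unfolding group_extension_def using N K.factorgroup_is_group G.is_group assms(7) by blast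
  qed
  moreover have "residually_solvable G"
    unfolding assms(7) by (rule G.free_by_nilpotent_residually_solvable[OF K nil \<beta>])
  ultimately show ?thesis using nil unfolding assms(7) by blast
qed

end
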